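(* Let $V$ and $H$ be separable Hilbert spaces such that the embedding $V\hookrightarrow H$ is dense (but not necessarily compact), let $\Sigma$ be a dictionary of $V$, let $a:V\times V\to\mathbb{R}$ be a symmetric continuous bilinear form for which there exist $\gamma,\nu>0$ such that $a(v,v)\geq\gamma\|v\|_V^2-\nu\|v\|^2$ for all $v\in V$, and let $A$ be the self-adjoint operator on $H$ associated to $a(\cdot,\cdot)$. Assume that $\min\sigma(A)<\min\sigma_{\rm ess}(A)$, where $\sigma(A)$ and $\sigma_{\rm ess}(A)$ denote the spectrum and the essential spectrum of $A$, and that the initial guess $u_0$ satisfies $\min\sigma(A)\le\lambda_0:=a(u_0,u_0)<\min\sigma_{\rm ess}(A)$. Then the following properties hold for both the PReGA and the OReGA (described in the context), $(u_n)_{n\in\mathbb{N}}$ and $(\lambda_n)_{n\in\mathbb{N}}$ denoting any sequences produced by the algorithm: \begin{enumerate} \item All the iterations of the algorithm are well-defined (i.e. at each iteration $n\ge1$ the minimization problems involved have at least one solution). \item The sequence $(\lambda_n)_{n\in\mathbb{N}}$ is non-increasing and converges towards a limit $\lambda$ which is an eigenvalue of $a(\cdot,\cdot)$ for the scalar product $\langle\cdot,\cdot\rangle$ such that $\lambda<\min\sigma_{\rm ess}(A)$. \item The sequence $(u_n)_{n\in\mathbb{N}}$ is bounded in $V$, and any subsequence of $(u_n)_{n\in\mathbb{N}}$ which weakly converges in $V$ also strongly converges in $V$ towards an $H$-normalized eigenvector associated with $\lambda$. This implies in particular that $$d_a(u_n,F_\lambda):=\inf_{w\in F_\lambda}\|w-u_n\|_a\longrightarrow0\quad\text{as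 }n\to\infty,$$ where $F_\lambda$ denotes the set of $H$-normalized eigenvectors of $a(\cdot,\cdot)$ associated with $\lambda$. \item If $\lambda$ is a simple eigenvalue, then there exists an $H$-normalized eigenvector $w_\lambda$ associated with $\lambda$ such that the whole sequence $(u_n)_{n\in\mathbb{N}}$ converges to $w_\lambda$ strongly in $V$. \end{enumerate}
   Context: $V\subset H$ are real Hilbert spaces with scalar products $\langle\cdot,\cdot\rangle_V$, $\langle\cdot,\cdot\rangle$ and norms $\|\cdot\|_V$, $\|\cdot\|$ respectively. With $\nu$ as in the lower bound on $a$, set $\langle v,w\rangle_a:=a(v,w)+\nu\langle v,w\rangle$; this is a scalar product on $V$ whose norm $\|\cdot\|_a$ is equivalent to $\|\cdot\|_V$. The constant $\nu$ is fixed once and for all, and chosen (without loss of generality) so that $\|v\|_a\ge\|v\|$ for all $v\in V$. $A$ is the unique self-adjoint operator on $H$ with form domain $V$ associated with the quadratic form $a(\cdot,\cdot)$. Eigenvalues: $\mu\in\mathbb{R}$ is an eigenvalue of $a(\cdot,\cdot)$ (for $\langle\cdot,\cdot\rangle$) with associated eigenvector $\psi\in V\setminus\{0\}$ if $a(\psi,v)=\mu\langle\psi,v\rangle$ for all $v\in V$; $\psi$ is $H$-normalized if $\|\psi\|=1$. Dictionary: $\Sigma\subset V$ is a dictionary of $V$ if (1) $0\in\Sigma$ and $tz\in\Sigma$ for all $(z,t)\in\Sigma\times\mathbb{R}$; (2) $\Sigma$ is weakly closed in $V$; (3) $\mathrm{Span}(\Sigma)$ is dense in $V$. Rayleigh quotient: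 $\mathcal{J}(v):=a(v,v)/\|v\|^2$ for $v\in V\setminus\{0\}$, $\mathcal{J}(0):=+\infty$. PReGA (Pure Residual Greedy Algorithm): choose $u_0\in V$ with $\|u_0\|=1$ and let $\lambda_0:=a(u_0,u_0)$. For $n\ge1$: find $z_n\in\operatorname{argmin}_{z\in\Sigma}\ \frac12\|u_{n-1}+z\|_a^2-(\lambda_{n-1}+\nu)\langle u_{n-1},z\rangle$, and set $u_n:=\frac{u_{n-1}+z_n}{\|u_{n-1}+z_n\|}$, $\lambda_n:=a(u_n,u_n)$. OReGA (Orthogonal Residual Greedy Algorithm): choose $u_0\in V$ with $\|u_0\|=1$ and let $\lambda_0:=a(u_0,u_0)$. For $n\ge1$: find $z_n\in\Sigma$ solving the same minimization problem over $\Sigma$ as in the PReGA (with the current $u_{n-1},\lambda_{n-1}$); find $(c_0^{(n)},\dots,c_n^{(n)})\in\operatorname{argmin}_{(c_0,\dots,c_n)\in\mathbb{R}^{n+1}}\mathcal{J}(c_0u_0+c_1z_1+\cdots+c_nz_n)$ and set $u_n:=\frac{c_0^{(n)}u_0+c_1^{(n)}z_1+\cdots+c_n^{(n)}z_n}{\|c_0^{(n)}u_0+c_1^{(n)}z_1+\cdots+c_n^{(n)}z_n\|}$; if $\langle u_{n-1},u_n\rangle\le0$, replace $u_n$ by $-u_n$; set $\lambda_n:=a(u_n,u_n)$. *)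

theory Defs
  imports "HOL-Analysis.Analysis"
begin

text \<open>
  The inclusion of \<open>V\<close> in \<open>H\<close> is an injective bounded linear map \<open>\<iota>\<close> between two
  Hilbert space types, so \<open>\<langle>v, w\<rangle>\<close> and \<open>\<parallel>v\<parallel>\<close> (the structure of \<open>H\<close>) read
  \<open>\<iota> v \<bullet> \<iota> w\<close> and \<open>norm (\<iota> v)\<close>, while \<open>norm v\<close> is the norm of \<open>V\<close>.
\<close>

section \<open>Weak topology and dictionaries\<close>

text \<open>
  The coarsest topology making every bounded linear functional continuous: the type
  \<open>('a \<Rightarrow>\<^sub>L real) \<Rightarrow> real\<close> carries the topology of pointwise convergence.
\<close>

definition weak_topology :: "'a::real_normed_vector topology" where
  "weak_topology =
     pullback_topology UNIV (\<lambda>x (\<phi> :: 'a \<Rightarrow>\<^sub>L real). blinfun_apply \<phi> x) euclidean"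

lemma limitin_weak_topology:
  "limitin weak_topology u w F \<longleftrightarrow>
     (\<forall>\<phi> :: 'a::real_normed_vector \<Rightarrow>\<^sub>L real. ((\<lambda>n. blinfun_apply \<phi> (u n)) \<longlongrightarrow> blinfun_apply \<phi> w) F)"
proof -
  let ?e = "\<lambda>x (\<phi> :: 'a \<Rightarrow>\<^sub>L real). blinfun_apply \<phi> x"
  have "limitin weak_topology u w F \<longleftrightarrow> ((\<lambda>n. ?e (u n)) \<longlongrightarrow> ?e w) F"
    by (auto simp: limitin_def tendsto_def weak_topology_def openin_pullback_topology
        topspace_pullback_topology)
  also have "\<dots> \<longleftrightarrow> (\<forall>\<phi>. ((\<lambda>n. ?e (u n) \<phi>) \<longlongrightarrow> ?e w \<phi>) F)"
    by (simp add: limitin_componentwise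
        flip: limitin_canonical_iff euclidean_product_topology)
  finally show ?thesis .
qed

definition is_dictionary :: "'v::real_normed_vector set \<Rightarrow> bool" where
  "is_dictionary D \<longleftrightarrow>
     0 \<in> D \<and> (\<forall>z\<in>D. \<forall>t. t *\<^sub>R z \<in> D) \<and>
     closedin weak_topology D \<and>
     closure (span D) = UNIV"

section \<open>Self-adjoint operators and their spectra\<close>

text \<open>
  An unbounded operator on \<open>H\<close> is given by its graph. The operator associated with the form
  \<open>a\<close> (first representation theorem) has as domain the \<open>\<psi> \<in> V\<close> for which \<open>a \<psi>\<close> is
  represented by some \<open>f \<in> H\<close>, and maps \<open>\<psi>\<close> to \<open>f\<close>, which is unique since \<open>V\<close> is dense
  in \<open>H\<close>.
\<close>

definition form_operator ::
  "('v \<Rightarrow> 'v \<Rightarrow> real) \<Rightarrow> ('v \<Rightarrow> 'h::real_inner) \<Rightarrow> ('h \<times> 'h) set" where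
  "form_operator a \<iota> = {(\<iota> \<psi>, f) |\<psi> f. \<forall>v. a \<psi> v = f \<bullet> \<iota> v}"

text \<open>
  \<open>\<mu>\<close> is in the resolvent set iff \<open>T - \<mu>\<close> has an everywhere defined bounded inverse \<open>R\<close>.
  The Hilbert spaces are real, but the operators of interest are self-adjoint, so that the
  spectrum of the complexification is real and equal to the set below.
\<close>

definition op_spectrum :: "('h::real_normed_vector \<times> 'h) set \<Rightarrow> real set" where
  "op_spectrum T =
     - {\<mu>. \<exists>R. bounded_linear R \<and> (\<forall>x f. (x, f + \<mu> *\<^sub>R x) \<in> T \<longleftrightarrow> x = R f)}"

definition op_eigenspace :: "('h::real_normed_vector \<times> 'h) set \<Rightarrow> real \<Rightarrow> 'h set" where
  "op_eigenspace T \<mu> = {x. (x, \<mu> *\<^sub>R x) \<in> T}"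

text \<open>The discrete spectrum consists of the isolated eigenvalues of finite multiplicity.\<close>

definition discrete_spectrum :: "('h::real_normed_vector \<times> 'h) set \<Rightarrow> real set" where
  "discrete_spectrum T =
     {\<mu>. \<mu> isolated_in op_spectrum T \<and> op_eigenspace T \<mu> \<noteq> {0} \<and>
         (\<exists>B. finite B \<and> op_eigenspace T \<mu> = span B)}"

definition essential_spectrum :: "('h::real_normed_vector \<times> 'h) set \<Rightarrow> real set" where
  "essential_spectrum T = op_spectrum T - discrete_spectrum T"

text \<open>
  The spectrum and the essential spectrum of a self-adjoint operator that is bounded below are
  closed and bounded below, so when nonempty
  the infimum is the minimum. For the empty set (an empty essential spectrum, e.g. when
  \<open>\<iota>\<close> is compact) the value is \<open>\<infinity>\<close>.
\<close>

definition spectral_min :: "real set \<Rightarrow> ereal" where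
  "spectral_min S = Inf (ereal ` S)"

section \<open>Quantities derived from the form\<close>

definition energy_norm ::
  "('v \<Rightarrow> 'v \<Rightarrow> real) \<Rightarrow> ('v \<Rightarrow> 'h::real_inner) \<Rightarrow> real \<Rightarrow> 'v \<Rightarrow> real" where
  "energy_norm a \<iota> \<nu> v = sqrt (a v v + \<nu> * (\<iota> v \<bullet> \<iota> v))"

text \<open>All \<open>\<psi>\<close> solving the eigenvalue equation, including \<open>0\<close>.\<close>

definition form_eigenspace ::
  "('v \<Rightarrow> 'v \<Rightarrow> real) \<Rightarrow> ('v \<Rightarrow> 'h::real_inner) \<Rightarrow> real \<Rightarrow> 'v set" where
  "form_eigenspace a \<iota> \<mu> = {\<psi>. \<forall>v. a \<psi> v = \<mu> * (\<iota> \<psi> \<bullet> \<iota> v)}"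

definition form_eigenvalue ::
  "('v::zero \<Rightarrow> 'v \<Rightarrow> real) \<Rightarrow> ('v \<Rightarrow> 'h::real_inner) \<Rightarrow> real \<Rightarrow> bool" where
  "form_eigenvalue a \<iota> \<mu> \<longleftrightarrow> (\<exists>\<psi>. \<psi> \<noteq> 0 \<and> \<psi> \<in> form_eigenspace a \<iota> \<mu>)"

definition normalized_eigenvectors ::
  "('v::zero \<Rightarrow> 'v \<Rightarrow> real) \<Rightarrow> ('v \<Rightarrow> 'h::real_inner) \<Rightarrow> real \<Rightarrow> 'v set" where
  "normalized_eigenvectors a \<iota> \<mu> =
     {\<psi>. \<psi> \<noteq> 0 \<and> \<psi> \<in> form_eigenspace a \<iota> \<mu> \<and> norm (\<iota> \<psi>) = 1}"

definition rayleigh ::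
  "('v::zero \<Rightarrow> 'v \<Rightarrow> real) \<Rightarrow> ('v \<Rightarrow> 'h::real_inner) \<Rightarrow> 'v \<Rightarrow> ereal" where
  "rayleigh a \<iota> v = (if v = 0 then \<infinity> else ereal (a v v / (norm (\<iota> v))\<^sup>2))"

section \<open>The greedy algorithms\<close>

definition residual_argmin ::
  "('v::real_vector \<Rightarrow> 'v \<Rightarrow> real) \<Rightarrow> ('v \<Rightarrow> 'h::real_inner) \<Rightarrow> real \<Rightarrow> 'v set \<Rightarrow> 'v \<Rightarrow> real \<Rightarrow> 'v set" where
  "residual_argmin a \<iota> \<nu> D u l =
     {z. is_arg_min (\<lambda>z. 1/2 * (energy_norm a \<iota> \<nu> (u + z))\<^sup>2 - (l + \<nu>) * (\<iota> u \<bullet> \<iota> z))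
           (\<lambda>z. z \<in> D) z}"

definition h_normalize :: "('v::real_vector \<Rightarrow> 'h::real_inner) \<Rightarrow> 'v \<Rightarrow> 'v" where
  "h_normalize \<iota> v = v /\<^sub>R norm (\<iota> v)"

text \<open>
  Vectors \<open>(c\<^sub>0, \<dots>, c\<^sub>n)\<close> are represented by functions \<open>c\<close> on \<open>nat\<close> of which only the values
  at \<open>0, \<dots>, n\<close> are used.
\<close>

definition lin_comb ::
  "'v::real_vector \<Rightarrow> (nat \<Rightarrow> 'v) \<Rightarrow> nat \<Rightarrow> (nat \<Rightarrow> real) \<Rightarrow> 'v" where
  "lin_comb u0 z n c = c 0 *\<^sub>R u0 + (\<Sum>i=1..n. c i *\<^sub>R z i)"

definition rayleigh_argmin ::
  "('v::real_vector \<Rightarrow> 'v \<Rightarrow> real) \<Rightarrow> ('v \<Rightarrow> 'h::real_inner) \<Rightarrow> 'v \<Rightarrow> (nat \<Rightarrow> 'v) \<Rightarrow> nat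
     \<Rightarrow> (nat \<Rightarrow> real) set" where
  "rayleigh_argmin a \<iota> u0 z n =
     {c. is_arg_min (\<lambda>c. rayleigh a \<iota> (lin_comb u0 z n c)) (\<lambda>_. True) c}"

text \<open>
  Both step predicates state that \<open>z (Suc n)\<close> and \<open>u (Suc n)\<close> are admissible outcomes of
  iteration \<open>Suc n\<close>. The value \<open>z 0\<close> is never used.
\<close>

definition prega_step ::
  "('v::real_vector \<Rightarrow> 'v \<Rightarrow> real) \<Rightarrow> ('v \<Rightarrow> 'h::real_inner) \<Rightarrow> real \<Rightarrow> 'v set
     \<Rightarrow> (nat \<Rightarrow> 'v) \<Rightarrow> (nat \<Rightarrow> 'v) \<Rightarrow> (nat \<Rightarrow> real) \<Rightarrow> nat \<Rightarrow> bool" where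
  "prega_step a \<iota> \<nu> D u z lam n \<longleftrightarrow>
     z (Suc n) \<in> residual_argmin a \<iota> \<nu> D (u n) (lam n) \<and>
     u (Suc n) = h_normalize \<iota> (u n + z (Suc n))"

definition orega_step ::
  "('v::real_vector \<Rightarrow> 'v \<Rightarrow> real) \<Rightarrow> ('v \<Rightarrow> 'h::real_inner) \<Rightarrow> real \<Rightarrow> 'v set
     \<Rightarrow> (nat \<Rightarrow> 'v) \<Rightarrow> (nat \<Rightarrow> 'v) \<Rightarrow> (nat \<Rightarrow> real) \<Rightarrow> nat \<Rightarrow> bool" where
  "orega_step a \<iota> \<nu> D u z lam n \<longleftrightarrow>
     z (Suc n) \<in> residual_argmin a \<iota> \<nu> D (u n) (lam n) \<and>
     (\<exists>c \<in> rayleigh_argmin a \<iota> (u 0) z (Suc n).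
        let v = h_normalize \<iota> (lin_comb (u 0) z (Suc n) c)
        in u (Suc n) = (if \<iota> (u n) \<bullet> \<iota> v \<le> 0 then - v else v))"

text \<open>A run of \<open>N\<close> iterations starting from \<open>u0\<close>; only the values up to index \<open>N\<close> matter.\<close>

definition greedy_upto ::
  "((nat \<Rightarrow> 'v) \<Rightarrow> (nat \<Rightarrow> 'v) \<Rightarrow> (nat \<Rightarrow> real) \<Rightarrow> nat \<Rightarrow> bool) \<Rightarrow> ('v \<Rightarrow> 'v \<Rightarrow> real) \<Rightarrow> 'v \<Rightarrow> nat
     \<Rightarrow> (nat \<Rightarrow> 'v) \<Rightarrow> (nat \<Rightarrow> 'v) \<Rightarrow> (nat \<Rightarrow> real) \<Rightarrow> bool" where
  "greedy_upto step a u0 N u z lam \<longleftrightarrow>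
     u 0 = u0 \<and> (\<forall>n\<le>N. lam n = a (u n) (u n)) \<and> (\<forall>n<N. step u z lam n)"

definition greedy_run ::
  "((nat \<Rightarrow> 'v) \<Rightarrow> (nat \<Rightarrow> 'v) \<Rightarrow> (nat \<Rightarrow> real) \<Rightarrow> nat \<Rightarrow> bool) \<Rightarrow> ('v \<Rightarrow> 'v \<Rightarrow> real) \<Rightarrow> 'v
     \<Rightarrow> (nat \<Rightarrow> 'v) \<Rightarrow> (nat \<Rightarrow> 'v) \<Rightarrow> (nat \<Rightarrow> real) \<Rightarrow> bool" where
  "greedy_run step a u0 u z lam \<longleftrightarrow> (\<forall>N. greedy_upto step a u0 N u z lam)"

end

theory Submission
  imports Defs
begin

text \<open>
  For the minimizer \<open>z\<^sub>n\<close>, optimality along the line through \<open>z\<^sub>n\<close> gives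
  \<open>\<lambda>\<^sub>n\<^sub>-\<^sub>1 - \<lambda>\<^sub>n \<ge> \<parallel>z\<^sub>n\<parallel>\<^sub>a\<^sup>2 / \<parallel>u\<^sub>n\<^sub>-\<^sub>1 + z\<^sub>n\<parallel>\<^sup>2\<close>, so \<open>\<lambda>\<^sub>n\<close> decreases to a limit \<open>\<lambda>\<close> and \<open>z\<^sub>n \<rightarrow> 0\<close>.
  Optimality along the other lines of the dictionary bounds the residual
  \<open>a(u\<^sub>n, w) - \<lambda>\<^sub>n \<langle>u\<^sub>n, w\<rangle>\<close> by \<open>\<parallel>w\<parallel>\<^sub>a \<parallel>z\<^sub>n\<^sub>+\<^sub>1\<parallel>\<^sub>a\<close> for \<open>w\<close> in the dictionary, hence it tends to
  \<open>0\<close> for every \<open>w\<close>. A weak limit \<open>w\<close> of a subsequence therefore solves the eigenvalue equation,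
  and \<open>d\<^sub>n = u\<^sub>n - w\<close> is weakly null with \<open>a(d\<^sub>n, d\<^sub>n) - \<lambda> \<parallel>d\<^sub>n\<parallel>\<^sup>2 \<rightarrow> 0\<close>. On weakly null sequences
  the form \<open>a\<close> is asymptotically bounded below by any \<open>\<Lambda> < min \<sigma>\<^sub>e\<^sub>s\<^sub>s\<close> (Persson), so \<open>d\<^sub>n \<rightarrow> 0\<close>
  strongly.

  Without a spectral theorem, Persson's bound is obtained from the bounded self-adjoint operators
  \<open>S = 1 - (\<mu> + \<nu>) (A + \<nu>)\<^sup>-\<^sup>1\<close>. If \<open>\<mu>\<close> is not in the essential spectrum, then \<open>S\<close> is bounded below
  on the orthogonal complement of a finite-dimensional kernel, hence asymptotically on weakly null
  sequences. This allows \<open>\<mu>\<close> to be raised from \<open>-\<nu>\<close> to \<open>\<Lambda>\<close> without losing the asymptotic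
  nonnegativity of \<open>a - \<mu>\<close>.
\<close>

section \<open>Weak convergence in Hilbert spaces\<close>

lemma linear_coefficient_eq_0:
  fixes c k :: real
  assumes "\<And>t. 0 \<le> t\<^sup>2 * k + 2 * t * c"
  shows "c = 0"
proof (rule ccontr)
  assume c: "c \<noteq> 0"
  \<comment> \<open>At the trial point \<open>t = - c / d\<close> the quadratic times
    \<open>d\<^sup>2\<close> equals \<open>c\<^sup>2 * (k - 2 * d)\<close>, and this
    \<open>d\<close> makes it negative for either sign of \<open>k\<close>.\<close>
  define d where "d = \<bar>k\<bar> + 1"
  have d: "d > 0" by (simp add: d_def)
  have "d\<^sup>2 * ((- c / d)\<^sup>2 * k + 2 * (- c / d) * c) = c\<^sup>2 * (k - 2 * d)"
    using d by (simp add: power2_eq_square field_simps)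
  also have "\<dots> < 0" using c by (intro mult_pos_neg) (auto simp: d_def)
  finally have "(- c / d)\<^sup>2 * k + 2 * (- c / d) * c < 0" by (simp add: mult_less_0_iff)
  with assms[of "- c / d"] show False by linarith
qed

lemma psd_cauchy_schwarz:
  fixes b :: "'a::real_vector \<Rightarrow> 'a \<Rightarrow> real"
  assumes add: "\<And>x y z. b (x + y) z = b x z + b y z" and scale: "\<And>t x y. b (t *\<^sub>R x) y = t * b x y"
    and sym: "\<And>x y. b x y = b y x" and nonneg: "\<And>x. b x x \<ge> 0"
  shows "(b x y)\<^sup>2 \<le> b x x * b y y"
proof -
  have expand: "b (s *\<^sub>R x + t *\<^sub>R y) (s *\<^sub>R x + t *\<^sub>R y) = s\<^sup>2 * b x x + 2 * s * t * b x y + t\<^sup>2 * b y y" for s t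
  proof -
    have "b (s *\<^sub>R x + t *\<^sub>R y) w = s * b x w + t * b y w" for w
      by (simp add: add scale)
    moreover have "b w (s *\<^sub>R x + t *\<^sub>R y) = s * b w x + t * b w y" for w
      by (metis add scale sym)
    ultimately show ?thesis
      by (simp add: sym[of y x] power2_eq_square algebra_simps)
  qed
  show ?thesis
  proof (cases "b y y = 0")
    case False
    then have pos: "b y y > 0" using nonneg[of y] by simp
    \<comment> \<open>The coefficients \<open>b y y\<close> and \<open>- b x y\<close> give the
      component of \<open>x\<close> orthogonal to \<open>y\<close>, cleared of its
      denominator.\<close>
    have "0 \<le> (b y y)\<^sup>2 * b x x + 2 * b y y * (- b x y) * b x y + (- b x y)\<^sup>2 * b y y"
      using expand[of "b y y" "- b x y"] nonneg by metis
    also have "\<dots> = b y y * (b x x * b y y - (b x y)\<^sup>2)"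
      by (simp add: power2_eq_square algebra_simps)
    finally show ?thesis using pos by (simp add: zero_le_mult_iff)
  next
    case True
    have "0 \<le> t\<^sup>2 * b x x + 2 * t * b x y" for t
      using expand[of t 1] nonneg[of "t *\<^sub>R x + 1 *\<^sub>R y"] True by simp
    from linear_coefficient_eq_0[OF this] have "b x y = 0" .
    with True show ?thesis by simp
  qed
qed

section \<open>Riesz representation and orthogonal projection\<close>

text \<open>The solution minimizes \<open>b x x - 2 * f x\<close> on \<open>M\<close>: coercivity
  bounds this functional below and makes minimizing sequences Cauchy. A general closed subspace
  \<open>M\<close> covers both Riesz representation and orthogonal projection.\<close>

lemma coercive_riesz:
  fixes b :: "'a::{real_inner,complete_space} \<Rightarrow> 'a \<Rightarrow> real"
  assumes b: "bounded_bilinear b" and sym: "\<And>x y. b x y = b y x"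
    and g: "g > 0" and coercive: "\<And>x. b x x \<ge> g * (norm x)\<^sup>2"
    and M: "subspace M" "closed M" and f: "bounded_linear f"
  obtains w where "w \<in> M" "\<And>v. v \<in> M \<Longrightarrow> b w v = f v"
proof -
  interpret b: bounded_bilinear b by fact
  interpret f: bounded_linear f by fact
  define J where "J x = b x x - 2 * f x" for x
  obtain K where K: "\<And>x. norm (f x) \<le> norm x * K" using f.bounded by blast
  have low: "- (K\<^sup>2 / g) \<le> J x" for x
  proof -
    have "f x \<le> norm x * K" using K[of x] by simp
    moreover have "0 \<le> (g * norm x - K)\<^sup>2 / g" using g by simp
    moreover have "(g * norm x - K)\<^sup>2 / g = g * (norm x)\<^sup>2 - 2 * (norm x * K) + K\<^sup>2 / g"
      using g by (simp add: power2_eq_square field_simps)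
    ultimately show ?thesis using coercive[of x] by (simp add: J_def)
  qed
  define I where "I = (INF x\<in>M. J x)"
  have bdd: "bdd_below (J ` M)" using low by (rule bdd_belowI2)
  have I_le: "I \<le> J x" if "x \<in> M" for x unfolding I_def using bdd that by (rule cINF_lower)
  have ne: "M \<noteq> {}" using M(1) subspace_0 by blast
  have "\<exists>x\<in>M. J x < I + 1 / real (Suc n)" for n
    using cInf_lessD[of "J ` M" "I + 1 / real (Suc n)"] ne unfolding I_def by auto
  then obtain x where xM: "\<And>n. x n \<in> M" and xJ: "\<And>n. J (x n) < I + 1 / real (Suc n)" by metis
  \<comment> \<open>Parallelogram identity for \<open>b\<close>, with the midpoint of
    \<open>y\<close> and \<open>z\<close> as a competitor for the infimum \<open>I\<close>.\<close>
  have par: "g / 2 * (norm (y - z))\<^sup>2 \<le> J y + J z - 2 * I" if "y \<in> M" "z \<in> M" for y z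
  proof -
    have "(1/2) *\<^sub>R (y + z) \<in> M" using that M(1) by (simp add: subspace_add subspace_scale)
    from I_le[OF this] have "4 * I \<le> b (y + z) (y + z) - 4 * f (y + z)"
      by (simp add: J_def b.scaleR_left b.scaleR_right f.scaleR)
    moreover have "b (y - z) (y - z) + b (y + z) (y + z) = 2 * b y y + 2 * b z z"
      by (simp add: b.add_left b.add_right b.diff_left b.diff_right)
    ultimately show ?thesis using coercive[of "y - z"] by (simp add: J_def f.add)
  qed
  have "Cauchy x"
  proof (rule metric_CauchyI)
    fix e :: real assume e: "e > 0"
    obtain N where N: "1 / real (Suc N) < g * e\<^sup>2 / 4"
      using nat_approx_posE[of "g * e\<^sup>2 / 4"] e g by auto
    show "\<exists>N. \<forall>m\<ge>N. \<forall>n\<ge>N. dist (x m) (x n) < e"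
    proof (intro exI allI impI)
      fix m n assume "N \<le> m" "N \<le> n"
      then have "1 / real (Suc m) \<le> 1 / real (Suc N)" "1 / real (Suc n) \<le> 1 / real (Suc N)"
        by (auto intro!: frac_le)
      with par[OF xM xM, of m n] xJ[of m] xJ[of n] N
      have "g / 2 * (norm (x m - x n))\<^sup>2 < g / 2 * e\<^sup>2" by simp
      then have "(norm (x m - x n))\<^sup>2 < e\<^sup>2" using g by simp
      then show "dist (x m) (x n) < e" using e by (simp add: dist_norm power_less_imp_less_base)
    qed
  qed
  then obtain w where w: "x \<longlonglongrightarrow> w" using Cauchy_convergent_iff convergent_def by blast
  have wM: "w \<in> M" using closed_sequentially[OF M(2) xM w] .
  have "(\<lambda>n. J (x n)) \<longlonglongrightarrow> J w" unfolding J_def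
    by (intro tendsto_intros b.tendsto f.tendsto w)
  moreover have "(\<lambda>n. I + 1 / real (Suc n)) \<longlonglongrightarrow> I + 0"
    by (intro tendsto_intros LIMSEQ_Suc lim_1_over_n)
  ultimately have "J w \<le> I + 0"
    by (rule LIMSEQ_le) (use xJ less_imp_le in blast)
  then have min: "J w \<le> J v" if "v \<in> M" for v using I_le[OF that] by linarith
  have "b w v = f v" if v: "v \<in> M" for v
  proof -
    \<comment> \<open>This quadratic is \<open>J (w + t *\<^sub>R v) - J w\<close>; its slope at
      \<open>t = 0\<close> must vanish.\<close>
    have "0 \<le> t\<^sup>2 * b v v + 2 * t * (b w v - f v)" for t
    proof -
      have "J w \<le> J (w + t *\<^sub>R v)"
        using wM v M(1) by (intro min) (simp add: subspace_add subspace_scale)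
      then show ?thesis
        by (simp add: J_def b.add_left b.add_right b.scaleR_left b.scaleR_right f.add f.scaleR
            sym[of v w] power2_eq_square algebra_simps)
    qed
    from linear_coefficient_eq_0[OF this] show ?thesis by simp
  qed
  with wM show ?thesis using that by blast
qed

lemma riesz:
  fixes f :: "'a::{real_inner,complete_space} \<Rightarrow> real"
  assumes "bounded_linear f"
  obtains w where "\<And>v. f v = w \<bullet> v"
proof -
  obtain w where "\<And>v. w \<bullet> v = f v"
    using coercive_riesz[OF bounded_bilinear_inner inner_commute zero_less_one _ subspace_UNIV closed_UNIV assms]
    by (auto simp: power2_norm_eq_inner)
  then show ?thesis using that by metis
qed

lemma orthogonal_projection:
  fixes y :: "'a::{real_inner,complete_space}"
  assumes "subspace M" "closed M"
  obtains p where "p \<in> M" "\<And>v. v \<in> M \<Longrightarrow> (y - p) \<bullet> v = 0"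
proof -
  obtain p where "p \<in> M" "\<And>v. v \<in> M \<Longrightarrow> p \<bullet> v = y \<bullet> v"
    using coercive_riesz[OF bounded_bilinear_inner inner_commute zero_less_one _ assms bounded_linear_inner_right[of y]]
    by (auto simp: power2_norm_eq_inner)
  then show ?thesis using that by (simp add: inner_diff_left)
qed

section \<open>Weak convergence tested by inner products, and weak sequential compactness\<close>

lemma limitin_weak_topology_inner:
  fixes u :: "'b \<Rightarrow> 'a::{real_inner,complete_space}"
  shows "limitin weak_topology u w F \<longleftrightarrow> (\<forall>v. ((\<lambda>n. u n \<bullet> v) \<longlongrightarrow> w \<bullet> v) F)"
proof
  assume L: "limitin weak_topology u w F"
  show "\<forall>v. ((\<lambda>n. u n \<bullet> v) \<longlongrightarrow> w \<bullet> v) F"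
  proof
    fix v
    from L have "((\<lambda>n. blinfun_apply (Blinfun (\<lambda>x. x \<bullet> v)) (u n)) \<longlongrightarrow> blinfun_apply (Blinfun (\<lambda>x. x \<bullet> v)) w) F"
      by (simp add: limitin_weak_topology)
    then show "((\<lambda>n. u n \<bullet> v) \<longlongrightarrow> w \<bullet> v) F"
      by (simp add: bounded_linear_Blinfun_apply bounded_linear_inner_left)
  qed
next
  assume R: "\<forall>v. ((\<lambda>n. u n \<bullet> v) \<longlongrightarrow> w \<bullet> v) F"
  show "limitin weak_topology u w F" unfolding limitin_weak_topology
  proof
    fix \<phi> :: "'a \<Rightarrow>\<^sub>L real"
    obtain g where "\<And>v. blinfun_apply \<phi> v = g \<bullet> v" using riesz[OF blinfun.bounded_linear_right] by blast
    with R show "((\<lambda>n. blinfun_apply \<phi> (u n)) \<longlongrightarrow> blinfun_apply \<phi> w) F" by (simp add: inner_commute)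
  qed
qed

lemma limitin_weak_topology_functional:
  fixes u :: "'b \<Rightarrow> 'a::real_normed_vector" and f :: "'a \<Rightarrow> real"
  assumes "limitin weak_topology u w F" "bounded_linear f"
  shows "((\<lambda>n. f (u n)) \<longlongrightarrow> f w) F"
  using assms(1)[unfolded limitin_weak_topology, rule_format, of "Blinfun f"]
  by (simp add: bounded_linear_Blinfun_apply[OF assms(2)])

text \<open>The inner products with a countable dense set lie in a compact product of intervals. A
  subsequence along which they converge has convergent inner products with every vector, by density
  and boundedness, and Riesz representation turns the limit functional into a vector.\<close>

lemma bounded_sequence_weakly_convergent_subsequence:
  fixes x :: "nat \<Rightarrow> 'a::{real_inner,complete_space}"
  assumes sep: "separable_space (euclidean :: 'a topology)" and bdd: "bounded (range x)"
  obtains r w where "strict_mono r" "limitin weak_topology (x \<circ> r) w sequentially"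
proof -
  obtain B where B: "B > 0" "\<And>n. norm (x n) \<le> B" using bdd by (auto simp: bounded_pos)
  obtain C :: "'a set" where C: "countable C" "closure C = UNIV"
    using sep by (auto simp: separable_space_def)
  then have Cne: "C \<noteq> {}" by auto
  define d where "d = from_nat_into C"
  have ranged: "range d = C" using C Cne by (simp add: d_def range_from_nat_into)
  define X where "X n k = x n \<bullet> d k" for n k
  define P :: "(nat \<Rightarrow> real) set" where "P = (\<Pi>\<^sub>E k\<in>UNIV. {- (B * norm (d k))..B * norm (d k)})"
  have "compactin (product_topology (\<lambda>k::nat. euclidean :: real topology) UNIV) P"
    unfolding P_def by (subst compactin_PiE) auto
  then have "compact P" by (metis compactin_euclidean_iff euclidean_product_topology)
  \<comment> \<open>The product has countably many factors and is therefore a metric space, where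
    compactness yields convergent subsequences.\<close>
  then have "seq_compact P" by (simp add: compact_eq_seq_compact_metric)
  moreover have "X n \<in> P" for n
  proof -
    have "\<bar>x n \<bullet> d k\<bar> \<le> B * norm (d k)" for k
      using Cauchy_Schwarz_ineq2[of "x n" "d k"] B(2)[of n] by (meson mult_right_mono norm_ge_zero order_trans)
    then show ?thesis unfolding P_def X_def by (auto simp: abs_le_iff minus_le_iff)
  qed
  ultimately obtain L r where r: "strict_mono r" and L: "(X \<circ> r) \<longlonglongrightarrow> L"
    by (metis seq_compactE)
  have conv_d: "(\<lambda>n. x (r n) \<bullet> d k) \<longlonglongrightarrow> L k" for k
  proof -
    have "limitin (product_topology (\<lambda>k::nat. euclidean :: real topology) UNIV) (X \<circ> r) L sequentially"
      unfolding euclidean_product_topology limitin_canonical_iff by (rule L)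
    then show ?thesis by (simp add: limitin_componentwise X_def)
  qed
  have cauchy: "convergent (\<lambda>n. x (r n) \<bullet> v)" for v
  proof -
    have "Cauchy (\<lambda>n. x (r n) \<bullet> v)"
    proof (rule metric_CauchyI)
      fix e :: real assume e: "e > 0"
      have "v \<in> closure (range d)" using C ranged by simp
      then obtain k where k: "dist (d k) v < e / (3 * B)"
        unfolding closure_approachable using e B by (metis (mono_tags) divide_pos_pos image_iff mult_pos_pos zero_less_numeral)
      then have k': "\<bar>x n \<bullet> v - x n \<bullet> d k\<bar> < e / 3" for n
      proof -
        have "\<bar>x n \<bullet> (v - d k)\<bar> \<le> norm (x n) * norm (v - d k)" by (rule Cauchy_Schwarz_ineq2)
        also have "\<dots> \<le> B * norm (v - d k)" using B(2) by (simp add: mult_right_mono)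
        also have "\<dots> < B * (e / (3 * B))" using k B by (intro mult_strict_left_mono) (auto simp: dist_norm norm_minus_commute)
        finally show ?thesis using B by (simp add: inner_diff_right)
      qed
      have "Cauchy (\<lambda>n. x (r n) \<bullet> d k)" using conv_d LIMSEQ_imp_Cauchy by blast
      then obtain N where N: "\<And>m n. m \<ge> N \<Longrightarrow> n \<ge> N \<Longrightarrow> dist (x (r m) \<bullet> d k) (x (r n) \<bullet> d k) < e / 3"
        using e metric_CauchyD[of _ "e/3"] by (metis divide_pos_pos zero_less_numeral)
      show "\<exists>N. \<forall>m\<ge>N. \<forall>n\<ge>N. dist (x (r m) \<bullet> v) (x (r n) \<bullet> v) < e"
      proof (intro exI allI impI)
        fix m n assume "N \<le> m" "N \<le> n"
        with N[of m n] k'[of "r m"] k'[of "r n"] show "dist (x (r m) \<bullet> v) (x (r n) \<bullet> v) < e"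
          unfolding dist_real_def by linarith
      qed
    qed
    then show ?thesis by (simp add: Cauchy_convergent_iff)
  qed
  define f where "f v = lim (\<lambda>n. x (r n) \<bullet> v)" for v
  have f: "(\<lambda>n. x (r n) \<bullet> v) \<longlonglongrightarrow> f v" for v using cauchy[of v] by (simp add: f_def convergent_LIMSEQ_iff)
  have "bounded_linear f"
  proof (rule bounded_linear_intro[where K = B])
    fix v w
    have "(\<lambda>n. x (r n) \<bullet> (v + w)) \<longlonglongrightarrow> f v + f w" unfolding inner_add_right by (intro tendsto_intros f)
    then show "f (v + w) = f v + f w" using f LIMSEQ_unique by blast
  next
    fix c v
    have "(\<lambda>n. x (r n) \<bullet> (c *\<^sub>R v)) \<longlonglongrightarrow> c *\<^sub>R f v" unfolding inner_scaleR_right real_scaleR_def by (intro tendsto_intros f)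
    then show "f (c *\<^sub>R v) = c *\<^sub>R f v" using f LIMSEQ_unique by blast
  next
    fix v
    have "norm (x (r n) \<bullet> v) \<le> norm v * B" for n
      using Cauchy_Schwarz_ineq2[of "x (r n)" v] mult_right_mono[OF B(2)[of "r n"], of "norm v"]
      by (simp add: mult.commute)
    then show "norm (f v) \<le> norm v * B" using tendsto_norm[OF f[of v]] Lim_bounded by blast
  qed
  then obtain w where "\<And>v. f v = w \<bullet> v" using riesz by blast
  with f have "limitin weak_topology (x \<circ> r) w sequentially" by (simp add: limitin_weak_topology_inner)
  with r show ?thesis by (rule that)
qed

section \<open>Isolated points of the spectrum of a self-adjoint operator\<close>

text \<open>Cauchy-Schwarz for the semidefinite form \<open>Q x \<bullet> y\<close> at the pair
  \<open>x\<close>, \<open>Q x\<close>, followed by cancelling \<open>(norm (Q x))\<^sup>2\<close>.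
  It converts lower bounds on \<open>norm (Q x)\<close> into lower bounds on the quadratic
  form.\<close>

lemma psd_operator_norm_bound:
  fixes Q :: "'a::real_inner \<Rightarrow> 'a"
  assumes Q: "linear Q" and sym: "\<And>x y. Q x \<bullet> y = x \<bullet> Q y" and nonneg: "\<And>x. Q x \<bullet> x \<ge> 0"
    and M: "\<And>x. norm (Q x) \<le> M * norm x"
  shows "(norm (Q x))\<^sup>2 \<le> M * (Q x \<bullet> x)"
proof (cases "Q x = 0")
  case False
  have "(Q x \<bullet> Q x)\<^sup>2 \<le> (Q x \<bullet> x) * (Q (Q x) \<bullet> Q x)"
  proof (rule psd_cauchy_schwarz[where b = "\<lambda>x y. Q x \<bullet> y"])
    show "Q x \<bullet> y = Q y \<bullet> x" for x y using sym[of x y] by (simp add: inner_commute)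
  qed (simp_all add: nonneg linear_add[OF Q] linear_scale[OF Q] inner_add_left)
  also have "Q (Q x) \<bullet> Q x \<le> norm (Q (Q x)) * norm (Q x)" by (rule norm_cauchy_schwarz)
  also have "\<dots> \<le> M * norm (Q x) * norm (Q x)" using M by (simp add: mult_right_mono)
  finally have "(norm (Q x))\<^sup>2 * (norm (Q x))\<^sup>2 \<le> (Q x \<bullet> x) * M * (norm (Q x))\<^sup>2"
    using nonneg by (simp add: power2_norm_eq_inner[symmetric] power2_eq_square mult_left_mono mult.assoc)
  then have "(norm (Q x))\<^sup>2 * (norm (Q x))\<^sup>2 \<le> (M * (Q x \<bullet> x)) * (norm (Q x))\<^sup>2"
    by (simp only: mult.commute)
  then show ?thesis using False by (subst (asm) mult_le_cancel_right_pos) simp_all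
qed (use nonneg in simp)

text \<open>With \<open>m = inf \<parallel>S x - d x\<parallel> / \<parallel>x\<parallel>\<close>, the operator \<open>(S - d)\<^sup>2 - m\<^sup>2 = (S - d - m) (S - d + m)\<close>
  is not bounded below, hence one of its two factors is not.\<close>

lemma bounded_below_punctured_ball:
  fixes S :: "'a::real_inner \<Rightarrow> 'a"
  assumes S: "bounded_linear S" and sym: "\<And>x y. S x \<bullet> y = x \<bullet> S y"
    and res: "\<And>d. d \<noteq> 0 \<Longrightarrow> \<bar>d\<bar> < e \<Longrightarrow> \<exists>c>0. \<forall>x. norm (S x - d *\<^sub>R x) \<ge> c * norm x"
    and d: "2 * \<bar>d\<bar> < e"
  shows "norm (S x - d *\<^sub>R x) \<ge> \<bar>d\<bar> * norm x"
proof (rule ccontr)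
  interpret S: bounded_linear S by fact
  assume neg: "\<not> norm (S x - d *\<^sub>R x) \<ge> \<bar>d\<bar> * norm x"
  then have x0: "x \<noteq> 0" by auto
  define U where "U y = S y - d *\<^sub>R y" for y
  \<comment> \<open>In spectral terms, \<open>m\<close> is the distance from \<open>d\<close> to the
    spectrum of \<open>S\<close>; the negated claim makes it smaller than
    \<open>\<bar>d\<bar>\<close>.\<close>
  define m where "m = (INF y\<in>-{0}. norm (U y) / norm y)"
  have U: "bounded_linear U" unfolding U_def
    by (intro bounded_linear_sub S bounded_linear_scaleR_right)
  interpret U: bounded_linear U by fact
  have Usym: "U y \<bullet> z = y \<bullet> U z" for y z by (simp add: U_def inner_diff_left inner_diff_right sym)
  have bdd: "bdd_below ((\<lambda>y. norm (U y) / norm y) ` (-{0}))" by (rule bdd_belowI2[of _ 0]) simp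
  have m_le: "m * norm y \<le> norm (U y)" for y
  proof (cases "y = 0")
    case False
    then have "m \<le> norm (U y) / norm y" unfolding m_def by (intro cINF_lower bdd) auto
    with False show ?thesis by (simp add: field_simps)
  qed simp
  have m0: "m \<ge> 0" unfolding m_def using x0 by (intro cINF_greatest) auto
  have m_d: "m < \<bar>d\<bar>"
  proof -
    have "m * norm x < \<bar>d\<bar> * norm x" using neg m_le[of x] by (simp add: U_def)
    then show ?thesis using x0 by simp
  qed
  \<comment> \<open>From \<open>m < \<bar>d\<bar>\<close> and \<open>2 * \<bar>d\<bar> < e\<close>,
    both \<open>d + m\<close> and \<open>d - m\<close> are nonzero and of modulus below
    \<open>e\<close>, so \<open>res\<close> applies to each.\<close>
  obtain c1 where c1: "c1 > 0" "\<And>y. norm (S y - (d + m) *\<^sub>R y) \<ge> c1 * norm y"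
    using res[of "d + m"] m_d m0 d by (auto simp: abs_if split: if_splits)
  obtain c2 where c2: "c2 > 0" "\<And>y. norm (S y - (d - m) *\<^sub>R y) \<ge> c2 * norm y"
    using res[of "d - m"] m_d m0 d by (auto simp: abs_if split: if_splits)
  define Q where "Q y = U (U y) - m\<^sup>2 *\<^sub>R y" for y
  have Q: "bounded_linear Q" unfolding Q_def
    by (intro bounded_linear_sub bounded_linear_compose[OF U] U bounded_linear_scaleR_right)
  have Qform: "Q y \<bullet> y = (norm (U y))\<^sup>2 - (m * norm y)\<^sup>2" for y
    by (simp add: Q_def inner_diff_left Usym power2_norm_eq_inner power_mult_distrib)
  have Qlow: "c1 * c2 * norm y \<le> norm (Q y)" for y
  proof -
    define z where "z = S y - (d - m) *\<^sub>R y"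
    have "Q y = S z - (d + m) *\<^sub>R z"
      by (simp add: Q_def U_def z_def S.diff S.add S.scaleR algebra_simps power2_eq_square)
    then have "c1 * norm z \<le> norm (Q y)" using c1(2) by simp
    moreover have "c1 * (c2 * norm y) \<le> c1 * norm z" using c2(2) c1(1) by (simp add: z_def)
    ultimately show ?thesis by (simp add: mult.assoc)
  qed
  obtain K where K: "K > 0" "\<And>y. norm (Q y) \<le> K * norm y"
    using bounded_linear.pos_bounded[OF Q] by (auto simp: mult.commute)
  have "(norm (Q y))\<^sup>2 \<le> K * (Q y \<bullet> y)" for y
  proof (rule psd_operator_norm_bound)
    show "linear Q" using Q bounded_linear.linear by blast
    show "Q z \<bullet> w = z \<bullet> Q w" for z w by (simp add: Q_def inner_diff_left inner_diff_right Usym)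
    show "0 \<le> Q z \<bullet> z" for z using m_le[of z] m0 by (simp add: Qform power_mono)
  qed (rule K)
  moreover have "(c1 * c2 * norm y)\<^sup>2 \<le> (norm (Q y))\<^sup>2" for y
    using Qlow[of y] c1(1) c2(1) by (intro power_mono) auto
  ultimately have low: "(c1 * c2 * norm y)\<^sup>2 \<le> K * ((norm (U y))\<^sup>2 - (m * norm y)\<^sup>2)" for y
    unfolding Qform[symmetric] by (rule order_trans[rotated])
  then have gap: "(c1 * c2)\<^sup>2 / K + m\<^sup>2 \<le> (norm (U y) / norm y)\<^sup>2" if "y \<noteq> 0" for y
  proof -
    have "(c1 * c2)\<^sup>2 * (norm y)\<^sup>2 \<le> K * ((norm (U y))\<^sup>2 - m\<^sup>2 * (norm y)\<^sup>2)"
      using low[of y] by (simp add: power_mult_distrib)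
    then show ?thesis using that K(1) by (simp add: field_simps)
  qed
  \<comment> \<open>A uniform gap: it pushes every quotient up to
    \<open>sqrt (h + m\<^sup>2)\<close>, strictly above the infimum \<open>m\<close>.\<close>
  define h where "h = (c1 * c2)\<^sup>2 / K"
  have h: "h > 0" using c1 c2 K by (simp add: h_def)
  have "sqrt (h + m\<^sup>2) \<le> norm (U y) / norm y" if "y \<noteq> 0" for y
    using gap[OF that] by (intro real_le_lsqrt) (simp_all add: h_def)
  then have "sqrt (h + m\<^sup>2) \<le> m" unfolding m_def using x0 by (intro cINF_greatest) auto
  moreover have "sqrt (h + m\<^sup>2) > m" using h by (intro real_less_rsqrt) simp
  ultimately show False by simp
qed

text \<open>Squaring \<open>res\<close> cancels the terms
  \<open>d\<^sup>2 * (norm x)\<^sup>2\<close> and leaves an inequality linear in \<open>d\<close>;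
  the extreme values \<open>e / 2\<close> and \<open>- e / 2\<close> give the absolute value. In
  spectral terms, a spectrum that avoids the interval from \<open>- e\<close> to \<open>e\<close>
  except at \<open>0\<close> satisfies \<open>s\<^sup>2 \<ge> e * \<bar>s\<bar>\<close>.\<close>

lemma norm_square_operator_ge:
  fixes S :: "'a::real_inner \<Rightarrow> 'a"
  assumes sym: "\<And>x y. S x \<bullet> y = x \<bullet> S y" and e: "e > 0"
    and res: "\<And>d. 2 * \<bar>d\<bar> \<le> e \<Longrightarrow> norm (S x - d *\<^sub>R x) \<ge> \<bar>d\<bar> * norm x"
  shows "\<bar>S x \<bullet> x\<bar> * e \<le> (norm (S x))\<^sup>2"
proof -
  have "2 * d * (S x \<bullet> x) \<le> (norm (S x))\<^sup>2" if "2 * \<bar>d\<bar> \<le> e" for d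
  proof -
    have "(\<bar>d\<bar> * norm x)\<^sup>2 \<le> (norm (S x - d *\<^sub>R x))\<^sup>2"
      using res[OF that] by (intro power_mono) auto
    also have "\<dots> = (norm (S x))\<^sup>2 - 2 * d * (S x \<bullet> x) + d\<^sup>2 * (norm x)\<^sup>2"
      using sym[of x x]
      by (simp only: power2_norm_eq_inner inner_diff_left inner_diff_right inner_scaleR_left inner_scaleR_right)
        (simp add: power2_eq_square algebra_simps)
    finally show ?thesis by (simp add: power_mult_distrib)
  qed
  from this[of "e / 2"] this[of "- e / 2"] e show ?thesis by (auto simp: abs_if mult.commute)
qed

text \<open>The forms of \<open>S\<^sup>2 + e S\<close> and \<open>S\<^sup>2 - e S\<close> are positive semidefinite, and \<open>2 e S\<close> is the
  difference of the two operators while \<open>2 S\<^sup>2\<close> is their sum.\<close>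

lemma norm_le_norm_square_operator:
  fixes S :: "'a::real_inner \<Rightarrow> 'a"
  assumes S: "bounded_linear S" and sym: "\<And>x y. S x \<bullet> y = x \<bullet> S y" and e: "e > 0"
    and form: "\<And>x. \<bar>S x \<bullet> x\<bar> * e \<le> (norm (S x))\<^sup>2"
  shows "e * norm (S x) \<le> 2 * norm (S (S x))"
proof (cases "S x = 0")
  case False
  interpret S: bounded_linear S by fact
  define b where "b s x y = S x \<bullet> S y + s * e * (S x \<bullet> y)" for s x y
  have cs: "(b s x y)\<^sup>2 \<le> b s x x * b s y y" if "\<bar>s\<bar> = 1" for s x y
  proof (rule psd_cauchy_schwarz)
    show "b s (v + w) z = b s v z + b s w z" for v w z by (simp add: b_def S.add inner_add_left algebra_simps)
    show "b s (t *\<^sub>R v) w = t * b s v w" for t v w by (simp add: b_def S.scaleR algebra_simps)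
    show "b s v w = b s w v" for v w using sym[of v w] by (simp add: b_def inner_commute)
    show "0 \<le> b s v v" for v
    proof -
      have "\<bar>s * e * (S v \<bullet> v)\<bar> \<le> S v \<bullet> S v"
        using form[of v] that e by (simp add: abs_mult power2_norm_eq_inner mult.commute)
      then show ?thesis by (simp add: b_def)
    qed
  qed
  define y where "y = S x"
  define p where "p = S x \<bullet> S x"
  define q where "q = S y \<bullet> S y"
  define s where "s = e * (S x \<bullet> x)"
  define t where "t = e * (S y \<bullet> y)"
  define r where "r = S x \<bullet> S y"
  have pp: "p > 0" using False by (simp add: p_def)
  \<comment> \<open>Cauchy-Schwarz for both forms at the pair \<open>x\<close>, \<open>S x\<close>.
    In the sum of the two inequalities the mixed terms in \<open>r * p\<close> cancel.\<close>
  have 1: "(r + e * p)\<^sup>2 \<le> (p + s) * (q + t)" "(r - e * p)\<^sup>2 \<le> (p - s) * (q - t)"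
    using cs[of 1 x y] cs[of "-1" x y] by (simp_all add: b_def p_def q_def s_def t_def r_def y_def)
  have "\<bar>s\<bar> \<le> p" "\<bar>t\<bar> \<le> q"
    using form[of x] form[of y] e
    by (simp_all add: s_def t_def p_def q_def power2_norm_eq_inner abs_mult mult.commute)
  then have "\<bar>s * t\<bar> \<le> p * q" unfolding abs_mult by (intro mult_mono) auto
  then have "s * t \<le> p * q" by simp
  moreover have "2 * r\<^sup>2 + 2 * (e\<^sup>2 * p\<^sup>2) \<le> 2 * (p * q + s * t)"
    using add_mono[OF 1] by (simp add: power2_eq_square algebra_simps)
  moreover have "r\<^sup>2 \<ge> 0" by simp
  ultimately have "2 * (e\<^sup>2 * p\<^sup>2) \<le> 2 * (2 * (p * q))"
    unfolding distrib_left by argo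
  then have "e\<^sup>2 * p\<^sup>2 \<le> 2 * (p * q)" by (simp only: mult_le_cancel_left_pos[OF zero_less_numeral])
  then have "e\<^sup>2 * p \<le> 2 * q" using pp by (simp add: power2_eq_square)
  moreover have "q \<ge> 0" by (simp add: q_def)
  \<comment> \<open>The constant is relaxed from \<open>2\<close> to \<open>4\<close> so that its
    square root is rational.\<close>
  ultimately have "e\<^sup>2 * p \<le> 4 * q" by linarith
  then have "(e * norm (S x))\<^sup>2 \<le> (2 * norm (S (S x)))\<^sup>2"
    by (simp add: p_def q_def y_def power_mult_distrib power2_norm_eq_inner)
  then show ?thesis by (rule power2_le_imp_le) simp
qed simp

section \<open>Self-adjoint operators on weakly null sequences\<close>

lemma subspace_closure:
  fixes M :: "'a::real_normed_vector set"
  assumes "subspace M"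
  shows "subspace (closure M)"
proof (rule subspaceI)
  show "0 \<in> closure M" using subspace_0[OF assms] closure_subset by blast
next
  fix x y assume "x \<in> closure M" "y \<in> closure M"
  then obtain f g where fg: "\<And>n. f n \<in> M" "f \<longlonglongrightarrow> x" "\<And>n. g n \<in> M" "g \<longlonglongrightarrow> y"
    unfolding closure_sequential by blast
  then have "(\<lambda>n. f n + g n) \<longlonglongrightarrow> x + y" by (intro tendsto_add)
  moreover have "f n + g n \<in> M" for n using assms fg by (simp add: subspace_add)
  ultimately show "x + y \<in> closure M"
    unfolding closure_sequential by (intro exI[of _ "\<lambda>n. f n + g n"]) simp
next
  fix c x assume "x \<in> closure M"
  then obtain f where f: "\<And>n. f n \<in> M" "f \<longlonglongrightarrow> x"
    unfolding closure_sequential by blast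
  then have "(\<lambda>n. c *\<^sub>R f n) \<longlonglongrightarrow> c *\<^sub>R x" by (intro tendsto_intros)
  moreover have "c *\<^sub>R f n \<in> M" for n using assms f by (simp add: subspace_scale)
  ultimately show "c *\<^sub>R x \<in> closure M"
    unfolding closure_sequential by (intro exI[of _ "\<lambda>n. c *\<^sub>R f n"]) simp
qed

text \<open>For symmetric \<open>S\<close> the orthogonal complement of the kernel is the closure of
  the range, and the bound known on the range extends to the closure by continuity.\<close>

lemma bounded_below_on_kernel_complement:
  fixes S :: "'a::{real_inner,complete_space} \<Rightarrow> 'a"
  assumes S: "bounded_linear S" and sym: "\<And>x y. S x \<bullet> y = x \<bullet> S y"
    and range: "\<And>x. c * norm (S x) \<le> norm (S (S x))"
    and y: "\<And>k. S k = 0 \<Longrightarrow> y \<bullet> k = 0"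
  shows "c * norm y \<le> norm (S y)"
proof -
  interpret S: bounded_linear S by fact
  have "subspace (closure (range S))"
    by (intro subspace_closure linear_subspace_image S.linear subspace_UNIV)
  then obtain p where p: "p \<in> closure (range S)"
    and orth: "\<And>v. v \<in> closure (range S) \<Longrightarrow> (y - p) \<bullet> v = 0"
    using orthogonal_projection[of "closure (range S)" y] by auto
  \<comment> \<open>Orthogonality to the range puts \<open>y - p\<close> in the kernel. Both
    \<open>y\<close> and \<open>p\<close> are then orthogonal to \<open>y - p\<close>, so
    \<open>y = p\<close>.\<close>
  have "S (y - p) \<bullet> v = 0" for v
    using orth[of "S v"] closure_subset[of "range S"] by (auto simp: sym)
  from this[of "S (y - p)"] have "S (y - p) = 0" by simp
  from y[OF this] orth[OF p] have "(y - p) \<bullet> (y - p) = 0"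
    by (simp add: inner_diff_left inner_diff_right inner_commute)
  then have "y \<in> closure (range S)" using p by simp
  moreover have "closed {y. c * norm y \<le> norm (S y)}"
    by (intro closed_Collect_le continuous_intros S.continuous_on)
  moreover have "range S \<subseteq> {y. c * norm y \<le> norm (S y)}" using range by auto
  ultimately show ?thesis by (meson closure_minimal in_mono mem_Collect_eq)
qed

text \<open>Phrased by inner products rather than by \<open>weak_topology\<close>, so that symmetric
  operators can be moved onto the test vector, and bundled with the norm bound used in the error
  estimates.\<close>

definition weakly_null :: "(nat \<Rightarrow> 'a::real_inner) \<Rightarrow> bool" where
  "weakly_null d \<longleftrightarrow> bounded (range d) \<and> (\<forall>v. (\<lambda>n. d n \<bullet> v) \<longlonglongrightarrow> 0)"

lemma weakly_null_selfadjoint: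
  assumes "bounded_linear S" and sym: "\<And>x y. S x \<bullet> y = x \<bullet> S y" and d: "weakly_null d"
  shows "weakly_null (\<lambda>n. S (d n))"
proof -
  have "bounded (S ` range d)"
    using assms by (intro bounded_linear_image) (auto simp: weakly_null_def)
  with d show ?thesis by (simp add: weakly_null_def sym image_image)
qed

lemma weakly_null_scaleR:
  assumes "weakly_null d"
  shows "weakly_null (\<lambda>n. c *\<^sub>R d n)"
  using weakly_null_selfadjoint[where S = "(*\<^sub>R) c", OF bounded_linear_scaleR_right _ assms] by simp

lemma weakly_null_diff:
  assumes "weakly_null d" "weakly_null e"
  shows "weakly_null (\<lambda>n. d n - e n)"
proof -
  have "bounded (range (\<lambda>n. d n - e n))"
    using assms by (auto simp: weakly_null_def intro: bounded_minus_comp)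
  moreover have "(\<lambda>n. (d n - e n) \<bullet> v) \<longlonglongrightarrow> 0 - 0" for v
    unfolding inner_diff_left using assms by (intro tendsto_diff) (auto simp: weakly_null_def)
  ultimately show ?thesis by (simp add: weakly_null_def)
qed

text \<open>The projection is written with finitely many coefficient functionals so that it visibly
  turns weak convergence into norm convergence. A zero vector in \<open>C\<close> contributes
  nothing, since its term is a multiple of \<open>0\<close>.\<close>

lemma finite_dim_projection_expansion:
  fixes B :: "'a::real_inner set"
  assumes "finite B"
  obtains C where "finite C" "span C = span B"
    "\<And>x v. v \<in> span B \<Longrightarrow> (x - (\<Sum>c\<in>C. (x \<bullet> c / (c \<bullet> c)) *\<^sub>R c)) \<bullet> v = 0"
proof -
  obtain C where C: "finite C" "span C = span B" "pairwise orthogonal C"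
    using basis_orthogonal[OF assms] by blast
  have "(x - (\<Sum>c\<in>C. (x \<bullet> c / (c \<bullet> c)) *\<^sub>R c)) \<bullet> v = 0" if "v \<in> span C" for x v
    using that
  proof (induction rule: span_induct)
    case base
    show ?case by (auto simp: subspace_def inner_add_right)
  next
    case (step v)
    have "(\<Sum>c\<in>C. (x \<bullet> c / (c \<bullet> c)) *\<^sub>R c) \<bullet> v = (\<Sum>c\<in>C. if c = v then x \<bullet> v else 0)"
      unfolding inner_sum_left
    proof (rule sum.cong)
      fix c assume "c \<in> C"
      with step C(3) show "(x \<bullet> c / (c \<bullet> c)) *\<^sub>R c \<bullet> v = (if c = v then x \<bullet> v else 0)"
        by (cases "v = 0") (auto simp: pairwise_def orthogonal_def)
    qed simp
    then show ?case using step C(1) by (simp add: inner_diff_left)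
  qed
  with C(1,2) show ?thesis by (intro that[of C]) auto
qed

text \<open>The component of a weakly null sequence in the finite-dimensional kernel tends to
  \<open>0\<close> in norm, and on the complement \<open>S\<close> is bounded below by
  \<open>c\<close>.\<close>

lemma weyl_bound:
  fixes S :: "'a::{real_inner,complete_space} \<Rightarrow> 'a"
  assumes S: "bounded_linear S" and sym: "\<And>x y. S x \<bullet> y = x \<bullet> S y" and c: "c > 0"
    and range: "\<And>x. c * norm (S x) \<le> norm (S (S x))"
    and ker: "finite B" "{x. S x = 0} = span B"
    and d: "weakly_null d" and e: "e > 0"
  shows "\<forall>\<^sub>F n in sequentially. (norm (S (d n)))\<^sup>2 \<ge> c\<^sup>2 * (norm (d n))\<^sup>2 - e"
proof -
  interpret S: bounded_linear S by fact
  obtain C where C: "finite C" "span C = span B"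
    and orth: "\<And>x v. v \<in> span B \<Longrightarrow> (x - (\<Sum>b\<in>C. (x \<bullet> b / (b \<bullet> b)) *\<^sub>R b)) \<bullet> v = 0"
    using finite_dim_projection_expansion[OF ker(1)] by blast
  define P where "P x = (\<Sum>b\<in>C. (x \<bullet> b / (b \<bullet> b)) *\<^sub>R b)" for x
  have PB: "P x \<in> span B" for x
    unfolding P_def C(2)[symmetric] by (intro span_sum span_scale span_base)
  have SP: "S (P x) = 0" for x using PB ker(2) by blast
  \<comment> \<open>Pythagoras for \<open>x = (x - P x) + P x\<close>, where \<open>S\<close>
    annihilates \<open>P x\<close>.\<close>
  have est: "c\<^sup>2 * (norm x)\<^sup>2 - c\<^sup>2 * (norm (P x))\<^sup>2 \<le> (norm (S x))\<^sup>2" for x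
  proof -
    have "c * norm (x - P x) \<le> norm (S (x - P x))"
    proof (rule bounded_below_on_kernel_complement[OF S sym range])
      fix k assume "S k = 0"
      then have "k \<in> span B" using ker(2) by blast
      then show "(x - P x) \<bullet> k = 0" unfolding P_def by (rule orth)
    qed
    then have "(c * norm (x - P x))\<^sup>2 \<le> (norm (S x))\<^sup>2"
      using c by (intro power_mono) (auto simp: S.diff SP)
    moreover have "(norm x)\<^sup>2 = (norm (x - P x))\<^sup>2 + (norm (P x))\<^sup>2"
      using orth[OF PB, of x x]
      unfolding P_def[symmetric] power2_norm_eq_inner
      by (simp add: inner_diff_left inner_diff_right inner_commute)
    ultimately show ?thesis by (simp add: power_mult_distrib algebra_simps)
  qed
  have "(\<lambda>n. P (d n)) \<longlonglongrightarrow> (\<Sum>b\<in>C. (0 / (b \<bullet> b)) *\<^sub>R b)" unfolding P_def divide_inverse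
    using d by (intro tendsto_sum tendsto_scaleR tendsto_mult tendsto_const) (auto simp: weakly_null_def)
  then have "(\<lambda>n. c\<^sup>2 * (norm (P (d n)))\<^sup>2) \<longlonglongrightarrow> c\<^sup>2 * (norm (0::'a))\<^sup>2"
    by (intro tendsto_intros) simp
  then have "\<forall>\<^sub>F n in sequentially. c\<^sup>2 * (norm (P (d n)))\<^sup>2 < e"
    using e by (intro order_tendstoD(2)[where y = "c\<^sup>2 * (norm (0::'a))\<^sup>2"]) auto
  then show ?thesis by eventually_elim (use est in \<open>smt (verit)\<close>)
qed

text \<open>Nonnegativity of the form on the weakly null sequence \<open>d - S d / L\<close>, where \<open>L\<close> bounds the norm
  of \<open>S\<close>, makes \<open>S d \<bullet> d\<close> dominate \<open>\<parallel>S d\<parallel>\<^sup>2 / L\<close>.\<close>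

lemma weakly_null_form_step:
  fixes S :: "'a::real_inner \<Rightarrow> 'a"
  assumes S: "bounded_linear S" and sym: "\<And>x y. S x \<bullet> y = x \<bullet> S y"
    and nonneg: "\<And>d e. weakly_null d \<Longrightarrow> e > 0 \<Longrightarrow> \<forall>\<^sub>F n in sequentially. S (d n) \<bullet> d n \<ge> - e"
    and c: "c > 0" and weyl: "\<And>d e. weakly_null d \<Longrightarrow> e > 0 \<Longrightarrow>
      \<forall>\<^sub>F n in sequentially. (norm (S (d n)))\<^sup>2 \<ge> c * (norm (d n))\<^sup>2 - e"
  obtains k where "k > 0" "\<And>d e. weakly_null d \<Longrightarrow> e > 0 \<Longrightarrow>
      \<forall>\<^sub>F n in sequentially. S (d n) \<bullet> d n \<ge> k * (norm (d n))\<^sup>2 - e"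
proof -
  interpret S: bounded_linear S by fact
  obtain L where L: "L > 0" "\<And>x. norm (S x) \<le> L * norm x"
    using S.pos_bounded by (auto simp: mult.commute)
  \<comment> \<open>In the expansion at \<open>x - (1/L) *\<^sub>R S x\<close> the cross terms give
    \<open>- 2 / L * (norm (S x))\<^sup>2\<close>, and the last term gives back at most half of
    this.\<close>
  have est: "S (x - (1/L) *\<^sub>R S x) \<bullet> (x - (1/L) *\<^sub>R S x) \<le> S x \<bullet> x - (1/L) * (norm (S x))\<^sup>2" for x
  proof -
    have "S (S x) \<bullet> S x \<le> norm (S (S x)) * norm (S x)" by (rule norm_cauchy_schwarz)
    also have "\<dots> \<le> L * norm (S x) * norm (S x)" using L by (intro mult_right_mono) auto
    finally have "(1/L) * (1/L) * (S (S x) \<bullet> S x) \<le> (1/L) * (1/L) * (L * (norm (S x))\<^sup>2)"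
      using L(1) by (intro mult_left_mono) (auto simp: power2_eq_square)
    then have "(1/L) * (1/L) * (S (S x) \<bullet> S x) \<le> (1/L) * (norm (S x))\<^sup>2" using L(1) by simp
    moreover have "S (x - (1/L) *\<^sub>R S x) \<bullet> (x - (1/L) *\<^sub>R S x)
      = S x \<bullet> x - 2 * ((1/L) * (norm (S x))\<^sup>2) + (1/L) * (1/L) * (S (S x) \<bullet> S x)"
      using sym[of "S x" x]
      by (simp only: S.diff S.scaleR power2_norm_eq_inner inner_diff_left inner_diff_right
          inner_scaleR_left inner_scaleR_right) (simp add: algebra_simps)
    ultimately show ?thesis by linarith
  qed
  have "\<forall>\<^sub>F n in sequentially. S (d n) \<bullet> d n \<ge> c / L * (norm (d n))\<^sup>2 - e"
    if d: "weakly_null d" and e: "e > 0" for d e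
  proof -
    have "weakly_null (\<lambda>n. d n - (1/L) *\<^sub>R S (d n))"
      by (rule weakly_null_diff[OF d weakly_null_scaleR[OF weakly_null_selfadjoint[OF S sym d]]])
    from nonneg[OF this, of "e/2"] e
    have "\<forall>\<^sub>F n in sequentially. - (e/2) \<le> S (d n - (1/L) *\<^sub>R S (d n)) \<bullet> (d n - (1/L) *\<^sub>R S (d n))"
      by linarith
    moreover have "\<forall>\<^sub>F n in sequentially. c * (norm (d n))\<^sup>2 - L * e / 2 \<le> (norm (S (d n)))\<^sup>2"
      using weyl[OF d, of "L * e / 2"] L(1) e by simp
    ultimately show ?thesis
    proof eventually_elim
      case (elim n)
      have "(c * (norm (d n))\<^sup>2 - L * e / 2) / L \<le> (norm (S (d n)))\<^sup>2 / L"
        using elim(2) L(1) by (intro divide_right_mono) auto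
      then have "c / L * (norm (d n))\<^sup>2 - e / 2 \<le> (norm (S (d n)))\<^sup>2 / L"
        using L(1) by (simp add: diff_divide_distrib)
      with elim(1) est[of "d n"] show ?case by simp
    qed
  qed
  then show ?thesis using c L(1) by (intro that[of "c / L"]) auto
qed

text \<open>An elementary form of Persson's theorem, by a connectedness argument in the parameter: the
  \<open>m\<close> for which the form of \<open>1 - m T\<close> is asymptotically nonnegative contain \<open>0\<close>, have a largest
  element below \<open>m1\<close> by continuity, and by the preceding lemma this element can only be \<open>m1\<close>.\<close>

lemma weakly_null_form_nonneg:
  fixes T :: "'a::real_inner \<Rightarrow> 'a"
  assumes T: "bounded_linear T" and sym: "\<And>x y. T x \<bullet> y = x \<bullet> T y" and m1: "m1 \<ge> 0"
    and weyl: "\<And>m. 0 \<le> m \<Longrightarrow> m \<le> m1 \<Longrightarrow> \<exists>c>0. \<forall>d e. weakly_null d \<longrightarrow> e > 0 \<longrightarrow>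
      (\<forall>\<^sub>F n in sequentially. (norm (d n - m *\<^sub>R T (d n)))\<^sup>2 \<ge> c * (norm (d n))\<^sup>2 - e)"
    and d: "weakly_null d" and e: "e > 0"
  shows "\<forall>\<^sub>F n in sequentially. (d n - m1 *\<^sub>R T (d n)) \<bullet> d n \<ge> - e"
proof -
  interpret T: bounded_linear T by fact
  obtain L where L: "L > 0" "\<And>x. norm (T x) \<le> L * norm x"
    using T.pos_bounded by (auto simp: mult.commute)
  define good where "good m \<longleftrightarrow> (\<forall>d e. weakly_null d \<longrightarrow> e > 0 \<longrightarrow>
      (\<forall>\<^sub>F n in sequentially. (d n - m *\<^sub>R T (d n)) \<bullet> d n \<ge> - e))" for m
  \<comment> \<open>The form of \<open>1 - m T\<close> is Lipschitz in \<open>m\<close> with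
    constant \<open>L\<close>, relative to \<open>(norm x)\<^sup>2\<close>; this drives both the
    closedness and the openness argument.\<close>
  have change: "(x - m *\<^sub>R T x) \<bullet> x - \<bar>m' - m\<bar> * L * (norm x)\<^sup>2 \<le> (x - m' *\<^sub>R T x) \<bullet> x" for m m' x
  proof -
    have "\<bar>T x \<bullet> x\<bar> \<le> norm (T x) * norm x" by (rule Cauchy_Schwarz_ineq2)
    also have "\<dots> \<le> L * norm x * norm x" using L by (intro mult_right_mono) auto
    finally have "\<bar>m' - m\<bar> * \<bar>T x \<bullet> x\<bar> \<le> \<bar>m' - m\<bar> * (L * (norm x)\<^sup>2)"
      by (intro mult_left_mono) (auto simp: power2_eq_square)
    then have "(m' - m) * (T x \<bullet> x) \<le> \<bar>m' - m\<bar> * L * (norm x)\<^sup>2" by (simp add: abs_mult[symmetric])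
    then show ?thesis by (simp add: inner_diff_left algebra_simps)
  qed
  define X where "X = {m. 0 \<le> m \<and> m \<le> m1 \<and> good m}"
  have "good 0" unfolding good_def by (auto intro!: always_eventually intro: order_trans[of _ 0])
  then have X0: "0 \<in> X" using m1 by (simp add: X_def)
  have bdd: "bdd_above X" by (auto simp: X_def)
  define s where "s = Sup X"
  have s: "0 \<le> s" "s \<le> m1"
    using X0 bdd by (auto simp: s_def X_def intro: cSup_upper cSup_least)
  have "good s" unfolding good_def
  proof (intro allI impI)
    fix d :: "nat \<Rightarrow> 'a" and e :: real assume d: "weakly_null d" and e: "e > 0"
    obtain K where K: "K > 0" "\<And>n. norm (d n) \<le> K"
      using d unfolding weakly_null_def bounded_pos by auto
    \<comment> \<open>For a sequence bounded by \<open>K\<close>, moving \<open>m\<close> by less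
      than \<open>e / (2 * L * K\<^sup>2)\<close> costs at most \<open>e / 2\<close>.\<close>
    have "s - e / (2 * L * K\<^sup>2) < s" using e L K by simp
    then obtain m where m: "m \<in> X" "s - e / (2 * L * K\<^sup>2) < m"
      unfolding s_def using less_cSupD X0 by blast
    have ms: "m \<le> s" unfolding s_def using m bdd by (intro cSup_upper)
    have "\<forall>\<^sub>F n in sequentially. (d n - m *\<^sub>R T (d n)) \<bullet> d n \<ge> - (e / 2)"
      using m(1) d e by (simp add: X_def good_def)
    then show "\<forall>\<^sub>F n in sequentially. (d n - s *\<^sub>R T (d n)) \<bullet> d n \<ge> - e"
    proof eventually_elim
      case (elim n)
      have "\<bar>s - m\<bar> * L * (norm (d n))\<^sup>2 \<le> e / (2 * L * K\<^sup>2) * L * K\<^sup>2"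
        using m ms L(1) K e by (intro mult_mono power_mono) auto
      also have "\<dots> = e / 2" using L(1) K(1) by simp
      finally show ?case using elim change[where x = "d n" and m = m and m' = s] by linarith
    qed
  qed
  have "s = m1"
  proof (rule ccontr)
    assume "s \<noteq> m1"
    with s have sm: "s < m1" by simp
    define S where "S x = x - s *\<^sub>R T x" for x
    obtain c where c: "c > 0" "\<And>d e. weakly_null d \<Longrightarrow> e > 0 \<Longrightarrow>
        \<forall>\<^sub>F n in sequentially. (norm (S (d n)))\<^sup>2 \<ge> c * (norm (d n))\<^sup>2 - e"
      using weyl[OF s] unfolding S_def by blast
    obtain k where k: "k > 0" "\<And>d e. weakly_null d \<Longrightarrow> e > 0 \<Longrightarrow>
        \<forall>\<^sub>F n in sequentially. S (d n) \<bullet> d n \<ge> k * (norm (d n))\<^sup>2 - e"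
    proof (rule weakly_null_form_step[of S c])
      show "bounded_linear S" unfolding S_def
        by (intro bounded_linear_sub bounded_linear_ident bounded_linear_compose[OF bounded_linear_scaleR_right T])
      show "S x \<bullet> y = x \<bullet> S y" for x y by (simp add: S_def inner_diff_left inner_diff_right sym)
      show "\<forall>\<^sub>F n in sequentially. S (d n) \<bullet> d n \<ge> - e" if "weakly_null d" "e > 0" for d e
        using \<open>good s\<close> that by (simp add: good_def S_def)
    qed (use c in auto)
    \<comment> \<open>The strict lower bound \<open>k\<close> at \<open>s\<close> leaves room for a
      move of length \<open>k / L\<close>; the minimum keeps \<open>m\<close> within the range where
      \<open>weyl\<close> holds.\<close>
    define m where "m = min m1 (s + k / L)"
    have m: "s < m" "m \<le> m1" "m - s \<le> k / L" using sm k(1) L(1) by (auto simp: m_def)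
    have "good m" unfolding good_def
    proof (intro allI impI)
      fix d :: "nat \<Rightarrow> 'a" and e :: real assume d: "weakly_null d" and e: "e > 0"
      from k(2)[OF d e] show "\<forall>\<^sub>F n in sequentially. (d n - m *\<^sub>R T (d n)) \<bullet> d n \<ge> - e"
      proof eventually_elim
        case (elim n)
        have "\<bar>m - s\<bar> * L * (norm (d n))\<^sup>2 \<le> k / L * L * (norm (d n))\<^sup>2"
          using m L(1) by (intro mult_right_mono) auto
        also have "\<dots> = k * (norm (d n))\<^sup>2" using L(1) by simp
        finally show ?case
          using elim change[where x = "d n" and m = s and m' = m] by (simp add: S_def)
      qed
    qed
    with m s have "m \<in> X" by (simp add: X_def)
    then have "m \<le> s" unfolding s_def using bdd by (intro cSup_upper)
    with m show False by simp
  qed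
  with \<open>good s\<close> d e show ?thesis by (simp add: good_def)
qed

section \<open>Forms on an embedded Hilbert space\<close>

locale embedded_form =
  fixes \<iota> :: "'v::{real_inner,complete_space} \<Rightarrow> 'h::{real_inner,complete_space}"
    and a :: "'v \<Rightarrow> 'v \<Rightarrow> real" and \<gamma> \<nu> :: real
  assumes emb: "bounded_linear \<iota>" and inj_emb: "inj \<iota>"
    and form: "bounded_bilinear a" and sym: "\<And>v w. a v w = a w v"
    and gamma: "\<gamma> > 0" and nu: "\<nu> > 0"
    and lower: "\<And>v. a v v \<ge> \<gamma> * (norm v)\<^sup>2 - \<nu> * (norm (\<iota> v))\<^sup>2"
    and norm_le_energy: "\<And>v. norm (\<iota> v) \<le> energy_norm a \<iota> \<nu> v"
begin

sublocale \<iota>: bounded_linear \<iota> by (rule emb)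
sublocale a: bounded_bilinear a by (rule form)

text \<open>The scalar product of \<open>energy_norm\<close>. Working with \<open>b v v\<close> in
  place of the norm keeps square roots out of the estimates.\<close>

definition b :: "'v \<Rightarrow> 'v \<Rightarrow> real" where "b v w = a v w + \<nu> * (\<iota> v \<bullet> \<iota> w)"

sublocale b: bounded_bilinear b
proof -
  interpret h: bounded_bilinear "\<lambda>v w. \<iota> v \<bullet> \<iota> w"
    by (rule bounded_bilinear.comp[OF bounded_bilinear_inner emb emb])
  obtain K where K: "\<And>v w. norm (a v w) \<le> norm v * norm w * K" using a.bounded by blast
  obtain M where M: "\<And>v w. norm (\<iota> v \<bullet> \<iota> w) \<le> norm v * norm w * M" using h.bounded by blast
  have "norm (b v w) \<le> norm v * norm w * (K + \<nu> * M)" for v w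
  proof -
    have "norm (b v w) \<le> norm (a v w) + \<nu> * norm (\<iota> v \<bullet> \<iota> w)"
      using nu abs_triangle_ineq[of "a v w" "\<nu> * (\<iota> v \<bullet> \<iota> w)"] by (simp add: b_def abs_mult)
    also have "\<dots> \<le> norm v * norm w * K + \<nu> * (norm v * norm w * M)"
      using nu by (intro add_mono mult_left_mono K M) simp
    finally show ?thesis by (simp add: algebra_simps)
  qed
  then have "\<exists>K. \<forall>v w. norm (b v w) \<le> norm v * norm w * K" by blast
  then show "bounded_bilinear b"
    by (intro bounded_bilinear.intro) (simp_all add: b_def a.add_left a.add_right a.scaleR_left a.scaleR_right
        h.add_left h.add_right h.scaleR_left h.scaleR_right algebra_simps)
qed

lemma b_sym: "b v w = b w v"
  by (simp add: b_def sym[of v w] inner_commute)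

lemma b_coercive: "b v v \<ge> \<gamma> * (norm v)\<^sup>2"
  using lower[of v] by (simp add: b_def power2_norm_eq_inner)

lemma b_nonneg: "0 \<le> b v v"
  by (rule order_trans[OF _ b_coercive]) (use gamma in simp)

lemma b_ge_inner: "\<iota> v \<bullet> \<iota> v \<le> b v v"
proof -
  have "(norm (\<iota> v))\<^sup>2 \<le> (energy_norm a \<iota> \<nu> v)\<^sup>2"
    using norm_le_energy by (intro power_mono) auto
  then show ?thesis using b_nonneg[of v] by (simp add: energy_norm_def b_def power2_norm_eq_inner)
qed

lemma energy_norm_b: "energy_norm a \<iota> \<nu> v = sqrt (b v v)"
  by (simp add: energy_norm_def b_def)

lemma b_eq_0_iff [simp]: "b v v = 0 \<longleftrightarrow> v = 0"
  using b_coercive[of v] gamma by (auto simp: b.zero_left mult_le_0_iff)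

lemma b_cauchy_schwarz: "(b v w)\<^sup>2 \<le> b v v * b w w"
  by (rule psd_cauchy_schwarz) (simp_all add: b.add_left b.scaleR_left b_nonneg, rule b_sym)

lemma b_riesz:
  assumes "bounded_linear f"
  obtains w where "\<And>v. b w v = f v"
proof (rule coercive_riesz[OF b.bounded_bilinear_axioms b_sym gamma b_coercive subspace_UNIV closed_UNIV assms])
  fix w assume "\<And>v. v \<in> UNIV \<Longrightarrow> b w v = f v"
  then show thesis by (intro that) simp
qed

lemma b_unique:
  assumes "\<And>v. b w v = b w' v"
  shows "w = w'"
proof -
  have "b (w - w') (w - w') = 0" by (simp only: b.diff_left assms diff_self)
  then show ?thesis by simp
qed

text \<open>The Hilbert space adjoint of \<iota> when the scalar product on its domain is
  \<open>b\<close>.\<close>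

definition adj :: "'h \<Rightarrow> 'v" where "adj f = (SOME w. \<forall>v. b w v = f \<bullet> \<iota> v)"

lemma b_adj: "b (adj f) v = f \<bullet> \<iota> v"
proof -
  have "bounded_linear (\<lambda>v. f \<bullet> \<iota> v)"
    by (rule bounded_linear_compose[OF bounded_linear_inner_right emb])
  then obtain w where "\<forall>v. b w v = f \<bullet> \<iota> v" using b_riesz by blast
  then have "\<forall>v. b (adj f) v = f \<bullet> \<iota> v" unfolding adj_def by (rule someI)
  then show ?thesis by simp
qed

lemma adj_unique: "(\<And>v. b w v = f \<bullet> \<iota> v) \<Longrightarrow> w = adj f"
  by (rule b_unique) (simp add: b_adj)

definition T :: "'h \<Rightarrow> 'h" where "T f = \<iota> (adj f)"

lemma b_adj_adj: "b (adj f) (adj g) = f \<bullet> T g"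
  by (simp add: b_adj T_def)

lemma T_sym: "T f \<bullet> g = f \<bullet> T g"
  using b_sym[of "adj f" "adj g"] by (simp add: b_adj_adj inner_commute)

sublocale T: bounded_linear T
proof (rule bounded_linear_intro[where K = 1])
  show "T (f + g) = T f + T g" for f g
    using adj_unique[of "adj f + adj g" "f + g"] by (simp add: T_def b.add_left b_adj inner_add_left flip: \<iota>.add)
  show "T (c *\<^sub>R f) = c *\<^sub>R T f" for c f
    using adj_unique[of "c *\<^sub>R adj f" "c *\<^sub>R f"] by (simp add: T_def b.scaleR_left b_adj flip: \<iota>.scaleR)
  show "norm (T f) \<le> norm f * 1" for f
  proof (cases "T f = 0")
    case False
    \<comment> \<open>The constant \<open>1\<close> comes from the normalization
      \<open>norm_le_energy\<close> of \<nu>, applied at \<open>adj f\<close>.\<close>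
    have "norm (T f) * norm (T f) \<le> f \<bullet> T f"
      using b_ge_inner[of "adj f"] by (simp add: b_adj_adj power2_norm_eq_inner flip: T_def power2_eq_square)
    also have "\<dots> \<le> norm f * norm (T f)" by (rule norm_cauchy_schwarz)
    finally show ?thesis using False by simp
  qed simp
qed

lemma bounded_linear_shift: "bounded_linear (\<lambda>x. x - m *\<^sub>R T x)"
proof -
  have "bounded_linear (\<lambda>x. m *\<^sub>R T x)"
    by (rule bounded_linear_const_scaleR[OF T.bounded_linear_axioms])
  from bounded_linear_sub[OF bounded_linear_ident this] show ?thesis .
qed

text \<open>Adding \<nu> times the inner product of H to both sides of the defining identity
  replaces \<open>a\<close> by \<open>b\<close>, whose Riesz map is \<open>adj\<close>. Statements
  about the unbounded graph thereby become equations for the bounded operator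
  \<open>T\<close>.\<close>

lemma form_operator_iff: "(x, g) \<in> form_operator a \<iota> \<longleftrightarrow> x = T (g + \<nu> *\<^sub>R x)"
proof
  assume "(x, g) \<in> form_operator a \<iota>"
  then obtain \<psi> where \<psi>: "x = \<iota> \<psi>" "\<And>v. a \<psi> v = g \<bullet> \<iota> v"
    by (auto simp: form_operator_def)
  then have "\<psi> = adj (g + \<nu> *\<^sub>R x)" by (intro adj_unique) (simp add: b_def inner_add_left)
  then show "x = T (g + \<nu> *\<^sub>R x)" using \<psi>(1) by (simp add: T_def)
next
  assume x: "x = T (g + \<nu> *\<^sub>R x)"
  have "a (adj (g + \<nu> *\<^sub>R x)) v = g \<bullet> \<iota> v" for v
    using b_adj[of "g + \<nu> *\<^sub>R x" v] x by (simp add: b_def T_def inner_add_left)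
  then show "(x, g) \<in> form_operator a \<iota>"
    using x unfolding form_operator_def T_def by blast
qed

section \<open>From the spectrum of the form operator to bounds for \<open>1 - m T\<close>\<close>

abbreviation "G \<equiv> form_operator a \<iota>"

text \<open>\<open>T = \<iota> \<iota>\<^sup>*\<close> is the inverse of \<open>A + \<nu>\<close>, so that \<open>A - \<mu>\<close> corresponds to \<open>1 - (\<mu> + \<nu>) T\<close>.\<close>

lemma resolvent_bounded_below:
  assumes "\<mu> \<notin> op_spectrum G"
  shows "\<exists>c>0. \<forall>x. norm (x - (\<mu> + \<nu>) *\<^sub>R T x) \<ge> c * norm x"
proof -
  have "\<exists>R. bounded_linear R \<and> (\<forall>x f. (x, f + \<mu> *\<^sub>R x) \<in> G \<longleftrightarrow> x = R f)"
    using assms by (simp only: op_spectrum_def Compl_iff not_not mem_Collect_eq)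
  then obtain R where R: "bounded_linear R" "\<forall>x f. (x, f + \<mu> *\<^sub>R x) \<in> G \<longleftrightarrow> x = R f"
    by (elim exE conjE)
  obtain K where K: "K > 0" "\<And>x. norm (R x) \<le> norm x * K"
    using bounded_linear.pos_bounded[OF R(1)] by auto
  define m where "m = \<mu> + \<nu>"
  have est: "norm y \<le> (1 + \<bar>m\<bar> * K) * norm (y - m *\<^sub>R T y)" for y
  proof -
    \<comment> \<open>The vector \<open>T y\<close> is in the domain of the operator, and the
      operator minus \<open>\<mu>\<close> sends it to \<open>y - m *\<^sub>R T y\<close>.\<close>
    have "(T y, (y - m *\<^sub>R T y) + \<mu> *\<^sub>R T y) \<in> G"
      unfolding form_operator_iff by (simp add: m_def algebra_simps)
    then have Ty: "T y = R (y - m *\<^sub>R T y)" using R(2) by blast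
    have "norm y = norm ((y - m *\<^sub>R T y) + m *\<^sub>R T y)" by simp
    also have "\<dots> \<le> norm (y - m *\<^sub>R T y) + \<bar>m\<bar> * norm (T y)"
      by (rule order_trans[OF norm_triangle_ineq]) simp
    also have "\<dots> \<le> norm (y - m *\<^sub>R T y) + \<bar>m\<bar> * (norm (y - m *\<^sub>R T y) * K)"
      using K(2)[of "y - m *\<^sub>R T y"] Ty by (intro add_left_mono mult_left_mono) auto
    finally show ?thesis by (simp add: algebra_simps)
  qed
  have pos: "1 + \<bar>m\<bar> * K > 0" using K(1) by (simp add: add_pos_nonneg)
  show ?thesis
  proof (intro exI[of _ "1 / (1 + \<bar>m\<bar> * K)"] conjI allI)
    show "1 / (1 + \<bar>m\<bar> * K) * norm x \<le> norm (x - (\<mu> + \<nu>) *\<^sub>R T x)" for x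
      using est[of x] pos by (simp add: m_def divide_le_eq mult.commute)
  qed (use pos in simp)
qed

text \<open>For small nonzero \<open>d\<close>, \<open>S - d\<close> is a nonzero multiple of
  \<open>1 - m' T\<close> with \<open>m'\<close> near but different from
  \<open>\<mu> + \<nu>\<close>, hence bounded below because \<open>\<mu>\<close> is isolated. The
  bounds for isolated spectral points then apply to \<open>S\<close> at \<open>0\<close>.\<close>

lemma discrete_range_bound:
  assumes \<mu>: "\<mu> \<in> discrete_spectrum G" and m: "\<mu> + \<nu> > 0"
  shows "\<exists>c>0. \<forall>x. let S = (\<lambda>x. x - (\<mu> + \<nu>) *\<^sub>R T x) in c * norm (S x) \<le> norm (S (S x))"
proof -
  define m where "m = \<mu> + \<nu>"
  define S where "S x = x - m *\<^sub>R T x" for x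
  have S: "bounded_linear S" unfolding S_def
    by (rule bounded_linear_shift)
  have Ssym: "S x \<bullet> y = x \<bullet> S y" for x y by (simp add: S_def inner_diff_left inner_diff_right T_sym)
  obtain e where e: "e > 0" "\<And>\<mu>'. \<mu>' \<noteq> \<mu> \<Longrightarrow> \<bar>\<mu>' - \<mu>\<bar> < e \<Longrightarrow> \<mu>' \<notin> op_spectrum G"
  proof -
    have "\<mu> isolated_in op_spectrum G" using \<mu> by (simp add: discrete_spectrum_def)
    then obtain e where "e > 0" "\<forall>y\<in>op_spectrum G. dist \<mu> y < e \<longrightarrow> y = \<mu>"
      unfolding isolated_in_dist_Ex_iff by (elim conjE exE)
    then show ?thesis using that[of e] by (auto simp: dist_real_def abs_minus_commute)
  qed
  \<comment> \<open>The entry \<open>1/2\<close> keeps \<open>1 - d\<close> above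
    \<open>1/2\<close>; the other entry gives
    \<open>\<bar>m' - m\<bar> \<le> 2 * m * \<bar>d\<bar> < e\<close>.\<close>
  define r where "r = min (1/2) (e / (2 * m))"
  have r: "r > 0" using e m by (simp add: r_def m_def)
  have res: "\<exists>c>0. \<forall>x. norm (S x - d *\<^sub>R x) \<ge> c * norm x" if d: "d \<noteq> 0" "\<bar>d\<bar> < r" for d
  proof -
    have m0: "m > 0" using m by (simp add: m_def)
    have d1: "\<bar>d\<bar> < 1/2" and d2: "2 * m * \<bar>d\<bar> < e" using d(2) m0 by (auto simp: r_def field_simps)
    then have d3: "1 - d > 1/2" by linarith
    \<comment> \<open>Chosen so that \<open>(1 - d) * m' = m\<close>, that is,
      \<open>S - d = (1 - d) (1 - m' T)\<close>.\<close>
    define m' where "m' = m / (1 - d)"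
    have diff: "m' - m = m * d / (1 - d)" using d3 by (simp add: m'_def field_simps)
    have "\<bar>m' - m\<bar> = m * \<bar>d\<bar> / (1 - d)" using d3 m0 by (simp add: diff abs_mult)
    also have "\<dots> \<le> m * \<bar>d\<bar> / (1/2)" using d3 m0 by (intro divide_left_mono) auto
    also have "\<dots> < e" using d2 by simp
    finally have "\<bar>(m' - \<nu>) - \<mu>\<bar> < e" by (simp add: m_def)
    moreover have "m' - \<nu> \<noteq> \<mu>" using diff d d3 m0 by (auto simp: m_def)
    ultimately obtain c where c: "c > 0" "\<And>x. norm (x - m' *\<^sub>R T x) \<ge> c * norm x"
      using resolvent_bounded_below[of "m' - \<nu>"] e(2) by auto
    have "(1 - d) * m' = m" using d3 by (simp add: m'_def)
    then have "S x - d *\<^sub>R x = (1 - d) *\<^sub>R (x - m' *\<^sub>R T x)" for x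
      by (simp add: S_def scaleR_diff_right scaleR_diff_left)
    then have "norm (S x - d *\<^sub>R x) \<ge> (1 - d) * c * norm x" for x
      using d3 c(2)[of x] by (simp add: mult.assoc)
    then show ?thesis using c(1) d3 by (intro exI[of _ "(1 - d) * c"]) auto
  qed
  have "\<bar>d\<bar> * norm x \<le> norm (S x - d *\<^sub>R x)" if "2 * \<bar>d\<bar> \<le> r / 2" for d x
    by (rule bounded_below_punctured_ball[OF S Ssym res]) (use that r in auto)
  then have "\<bar>S x \<bullet> x\<bar> * (r / 2) \<le> (norm (S x))\<^sup>2" for x
    by (intro norm_square_operator_ge Ssym) (use r in auto)
  then have "(r / 2) * norm (S x) \<le> 2 * norm (S (S x))" for x
    by (intro norm_le_norm_square_operator S Ssym) (use r in auto)
  then have "(r / 4) * norm (S x) \<le> norm (S (S x))" for x by (simp add: field_simps)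
  then show ?thesis using r by (intro exI[of _ "r / 4"]) (simp add: S_def m_def Let_def)
qed

text \<open>At \<open>\<mu> = - \<nu>\<close> the operator is the identity; at a point of the
  resolvent set it is bounded below; at a discrete eigenvalue it is bounded below up to a
  finite-dimensional kernel, which weakly null sequences do not see.\<close>

lemma weyl_outside_essential_spectrum:
  assumes \<mu>: "\<mu> \<notin> essential_spectrum G" and m: "\<mu> + \<nu> \<ge> 0"
  shows "\<exists>c>0. \<forall>d e. weakly_null d \<longrightarrow> e > 0 \<longrightarrow>
      (\<forall>\<^sub>F n in sequentially. (norm (d n - (\<mu> + \<nu>) *\<^sub>R T (d n)))\<^sup>2 \<ge> c * (norm (d n))\<^sup>2 - e)"
proof -
  consider "\<mu> + \<nu> = 0" | "\<mu> \<notin> op_spectrum G" | "\<mu> \<in> discrete_spectrum G" "\<mu> + \<nu> > 0"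
    using assms by (force simp: essential_spectrum_def)
  then show ?thesis
  proof cases
    case 1
    then show ?thesis by (intro exI[of _ 1]) auto
  next
    case 2
    obtain c where c: "c > 0" "\<And>x. c * norm x \<le> norm (x - (\<mu> + \<nu>) *\<^sub>R T x)"
      using resolvent_bounded_below[OF 2] by blast
    have "(c * norm x)\<^sup>2 \<le> (norm (x - (\<mu> + \<nu>) *\<^sub>R T x))\<^sup>2" for x
      using c by (intro power_mono) auto
    then have "c\<^sup>2 * (norm x)\<^sup>2 - e \<le> (norm (x - (\<mu> + \<nu>) *\<^sub>R T x))\<^sup>2" if "e > 0" for x e
      using that by (metis add_increasing2 diff_le_eq less_imp_le power_mult_distrib)
    then show ?thesis using c(1) by (intro exI[of _ "c\<^sup>2"]) (auto intro!: always_eventually)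
  next
    case 3
    define S where "S x = x - (\<mu> + \<nu>) *\<^sub>R T x" for x
    have S: "bounded_linear S" unfolding S_def
      by (rule bounded_linear_shift)
    have Ssym: "S x \<bullet> y = x \<bullet> S y" for x y by (simp add: S_def inner_diff_left inner_diff_right T_sym)
    obtain c where c: "c > 0" "\<And>x. c * norm (S x) \<le> norm (S (S x))"
      using discrete_range_bound[OF 3] unfolding Let_def S_def by blast
    obtain B where B: "finite B" "op_eigenspace G \<mu> = span B"
      using 3(1) by (auto simp: discrete_spectrum_def)
    have "op_eigenspace G \<mu> = {x. S x = 0}"
      unfolding op_eigenspace_def form_operator_iff S_def
      by (auto simp: T.scaleR T.add algebra_simps)
    with B have B': "{x. S x = 0} = span B" by simp
    show ?thesis
      using weyl_bound[OF S Ssym c B(1) B'] c(1) unfolding S_def[symmetric]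
      by (intro exI[of _ "c\<^sup>2"]) simp
  qed
qed

section \<open>Persson's bound and strong convergence of weakly null sequences\<close>

lemma less_spectral_min_notin:
  assumes "ereal \<mu> < spectral_min S"
  shows "\<mu> \<notin> S"
proof
  assume "\<mu> \<in> S"
  then have "spectral_min S \<le> ereal \<mu>" unfolding spectral_min_def by (intro Inf_lower imageI)
  with assms show False by simp
qed

text \<open>Each \<open>m\<close> between \<open>0\<close> and \<open>\<mu> + \<nu>\<close>
  corresponds to the spectral parameter \<open>m - \<nu> \<le> \<mu>\<close> below the essential
  spectrum, so the Weyl bound holds along the entire path.\<close>

lemma persson:
  assumes \<mu>: "ereal \<mu> < spectral_min (essential_spectrum G)" and m: "\<mu> + \<nu> \<ge> 0"
    and d: "weakly_null d" and e: "e > 0"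
  shows "\<forall>\<^sub>F n in sequentially. (d n - (\<mu> + \<nu>) *\<^sub>R T (d n)) \<bullet> d n \<ge> - e"
proof (rule weakly_null_form_nonneg[OF T.bounded_linear_axioms T_sym m _ d e])
  fix m assume "0 \<le> m" "m \<le> \<mu> + \<nu>"
  moreover have "m - \<nu> \<notin> essential_spectrum G"
    by (rule less_spectral_min_notin, rule le_less_trans[OF _ \<mu>]) (use \<open>m \<le> \<mu> + \<nu>\<close> in simp)
  ultimately show "\<exists>c>0. \<forall>d e. weakly_null d \<longrightarrow> e > 0 \<longrightarrow>
      (\<forall>\<^sub>F n in sequentially. (norm (d n - m *\<^sub>R T (d n)))\<^sup>2 \<ge> c * (norm (d n))\<^sup>2 - e)"
    using weyl_outside_essential_spectrum[of "m - \<nu>"] by simp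
qed

lemma weakly_null_embed:
  assumes "weakly_null d"
  shows "weakly_null (\<lambda>n. \<iota> (d n))"
proof -
  have "bounded (\<iota> ` range d)"
    using assms by (intro bounded_linear_image emb) (auto simp: weakly_null_def)
  moreover have "(\<lambda>n. \<iota> (d n) \<bullet> f) \<longlonglongrightarrow> 0" for f
  proof -
    have "bounded_linear (\<lambda>v. \<iota> v \<bullet> f)"
      by (rule bounded_linear_compose[OF bounded_linear_inner_left emb])
    then obtain g where "\<And>v. \<iota> v \<bullet> f = g \<bullet> v" using riesz by blast
    then show ?thesis using assms by (simp add: weakly_null_def inner_commute)
  qed
  ultimately show ?thesis by (simp add: weakly_null_def image_image)
qed

text \<open>Cauchy-Schwarz for \<open>b\<close> at the pair \<open>adj (\<iota> v)\<close>,
  \<open>v\<close>. It carries a bound on the form of \<open>T\<close> over to a bound involving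
  \<open>b v v\<close>.\<close>

lemma inner_square_le: "(\<iota> v \<bullet> \<iota> v)\<^sup>2 \<le> (T (\<iota> v) \<bullet> \<iota> v) * b v v"
proof -
  have "(b (adj (\<iota> v)) v)\<^sup>2 \<le> b (adj (\<iota> v)) (adj (\<iota> v)) * b v v" by (rule b_cauchy_schwarz)
  then show ?thesis unfolding b_adj T_def[symmetric] T_sym .
qed

text \<open>For \<open>m1\<close> slightly above \<open>m0\<close>, Persson's bound and
  \<open>inner_square_le\<close> give \<open>m1 * (h n)\<^sup>2 \<le> (h n + e) * \<beta> n\<close>,
  while \<open>\<beta> n\<close> is asymptotically \<open>m0 * h n\<close>. Hence
  \<open>(m1 - m0) * (h n)\<^sup>2\<close> tends to \<open>0\<close>, then so does
  \<open>\<beta> n\<close>, and coercivity gives norm convergence.\<close>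

lemma weakly_null_strong:
  assumes d: "weakly_null d" and m0: "m0 > 0"
    and ess: "ereal (m0 - \<nu>) < spectral_min (essential_spectrum G)"
    and lim: "(\<lambda>n. b (d n) (d n) - m0 * (\<iota> (d n) \<bullet> \<iota> (d n))) \<longlonglongrightarrow> 0"
  shows "d \<longlonglongrightarrow> 0"
proof -
  obtain l where l: "ereal (m0 - \<nu>) < ereal l" "ereal l < spectral_min (essential_spectrum G)"
    using ereal_dense2[OF ess] by blast
  define m1 where "m1 = l + \<nu>"
  have m1: "m0 < m1" using l(1) by (simp add: m1_def)
  define h where "h n = \<iota> (d n) \<bullet> \<iota> (d n)" for n
  define \<beta> where "\<beta> n = b (d n) (d n)" for n
  have d': "weakly_null (\<lambda>n. \<iota> (d n))" by (rule weakly_null_embed[OF d])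
  then obtain B' where "\<And>n. norm (\<iota> (d n)) \<le> B'" by (auto simp: weakly_null_def bounded_iff)
  then have hB: "h n \<le> B'\<^sup>2" for n
    unfolding h_def power2_norm_eq_inner[symmetric] by (intro power_mono) auto
  define B where "B = B'\<^sup>2"
  have B0: "0 \<le> B" by (simp add: B_def)
  have h0: "0 \<le> h n" for n by (simp add: h_def)
  have hlim: "h \<longlonglongrightarrow> 0"
  proof (rule LIMSEQ_I)
    fix \<delta> :: real assume \<delta>: "\<delta> > 0"
    \<comment> \<open>An upper bound for \<open>m0 * h n + h n + e\<close> as long as
      \<open>e \<le> 1\<close>; the choice of \<open>e\<close> below then makes \<open>e * C\<close>
      at most half of \<open>(m1 - m0) * \<delta>\<^sup>2\<close>.\<close>
    define C where "C = m0 * B + B + 1"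
    have C: "C > 0" using B0 m0 by (simp add: C_def add_nonneg_pos)
    define e where "e = min 1 ((m1 - m0) * \<delta>\<^sup>2 / (2 * C))"
    have e: "e > 0" "e \<le> 1" "e * C \<le> (m1 - m0) * \<delta>\<^sup>2 / 2"
      using \<delta> m1 C by (auto simp: e_def min_def field_simps)
    have "\<forall>\<^sub>F n in sequentially. (\<iota> (d n) - m1 *\<^sub>R T (\<iota> (d n))) \<bullet> \<iota> (d n) \<ge> - e"
      unfolding m1_def by (rule persson[OF l(2) _ d' e(1)]) (use m0 m1 in \<open>simp add: m1_def\<close>)
    moreover have "\<forall>\<^sub>F n in sequentially. \<beta> n - m0 * h n < e"
      using order_tendstoD(2)[OF lim e(1)] by (simp add: \<beta>_def h_def)
    ultimately have "\<forall>\<^sub>F n in sequentially. norm (h n - 0) < \<delta>"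
    proof eventually_elim
      case (elim n)
      have t: "m1 * (T (\<iota> (d n)) \<bullet> \<iota> (d n)) \<le> h n + e" using elim(1) by (simp add: inner_diff_left h_def)
      have "m1 * (h n)\<^sup>2 \<le> m1 * ((T (\<iota> (d n)) \<bullet> \<iota> (d n)) * \<beta> n)"
        using inner_square_le[of "d n"] m0 m1 by (intro mult_left_mono) (auto simp: h_def \<beta>_def)
      also have "\<dots> \<le> (h n + e) * \<beta> n"
        using mult_right_mono[OF t, of "\<beta> n"] b_nonneg[of "d n"] by (simp add: \<beta>_def mult.assoc)
      also have "\<dots> \<le> (h n + e) * (m0 * h n + e)"
        using elim(2) h0[of n] e by (intro mult_left_mono) auto
      finally have "(m1 - m0) * (h n)\<^sup>2 \<le> e * (m0 * h n + h n + e)"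
        by (simp add: power2_eq_square algebra_simps)
      also have "\<dots> \<le> e * C" unfolding C_def
        using e m0 hB[of n] by (intro mult_left_mono add_mono) (auto simp: B_def)
      also have "\<dots> < (m1 - m0) * \<delta>\<^sup>2"
      proof -
        have "(m1 - m0) * \<delta>\<^sup>2 > 0" using m1 \<delta> by simp
        with e(3) show ?thesis by linarith
      qed
      finally have "(h n)\<^sup>2 < \<delta>\<^sup>2" using m1 by simp
      then show ?case using \<delta> h0[of n] by (simp add: power_less_imp_less_base)
    qed
    then show "\<exists>N. \<forall>n\<ge>N. norm (h n - 0) < \<delta>" by (simp add: eventually_sequentially)
  qed
  have "(\<lambda>n. (\<beta> n - m0 * h n) + m0 * h n) \<longlonglongrightarrow> 0 + m0 * 0"
    using lim by (intro tendsto_intros hlim) (simp add: \<beta>_def h_def)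
  then have "\<beta> \<longlonglongrightarrow> 0" by simp
  then have "(\<lambda>n. sqrt (\<beta> n / \<gamma>)) \<longlonglongrightarrow> sqrt (0 / \<gamma>)"
    by (intro tendsto_intros) (use gamma in auto)
  moreover have "norm (d n) \<le> sqrt (\<beta> n / \<gamma>)" for n
    using b_coercive[of "d n"] gamma by (intro real_le_rsqrt) (simp add: \<beta>_def field_simps)
  ultimately have "(\<lambda>n. sqrt (\<beta> n / \<gamma>)) \<longlonglongrightarrow> 0" "\<forall>\<^sub>F n in sequentially. norm (d n) \<le> sqrt (\<beta> n / \<gamma>)"
    by simp_all
  then show ?thesis by (rule Lim_null_comparison[rotated])
qed

end

section \<open>The minimization problems\<close>

text \<open>Bolzano-Weierstrass from weak compactness: the projection onto the span fixes the
  sequence and makes its weakly convergent subsequence converge in norm.\<close>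

lemma bounded_sequence_in_finite_span:
  fixes x :: "nat \<Rightarrow> 'a::{real_inner,complete_space}"
  assumes sep: "separable_space (euclidean :: 'a topology)" and bdd: "bounded (range x)"
    and B: "finite B" and x: "\<And>n. x n \<in> span B"
  obtains r w where "strict_mono r" "w \<in> span B" "(x \<circ> r) \<longlonglongrightarrow> w"
proof -
  obtain C where C: "finite C" "span C = span B"
    and orth: "\<And>x v. v \<in> span B \<Longrightarrow> (x - (\<Sum>b\<in>C. (x \<bullet> b / (b \<bullet> b)) *\<^sub>R b)) \<bullet> v = 0"
    using finite_dim_projection_expansion[OF B] by blast
  define P where "P x = (\<Sum>b\<in>C. (x \<bullet> b / (b \<bullet> b)) *\<^sub>R b)" for x
  have PB: "P x \<in> span B" for x
    unfolding P_def C(2)[symmetric] by (intro span_sum span_scale span_base)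
  have Px: "P v = v" if "v \<in> span B" for v
  proof -
    have "v - P v \<in> span B" using that PB by (rule span_diff)
    then have "(v - P v) \<bullet> (v - P v) = 0" unfolding P_def by (rule orth)
    then show ?thesis by simp
  qed
  obtain r w where r: "strict_mono r" and w: "limitin weak_topology (x \<circ> r) w sequentially"
    using bounded_sequence_weakly_convergent_subsequence[OF sep bdd] by blast
  have "(\<lambda>n. P ((x \<circ> r) n)) \<longlonglongrightarrow> P w" unfolding P_def divide_inverse
    using w by (intro tendsto_sum tendsto_scaleR tendsto_mult tendsto_const) (auto simp: limitin_weak_topology_inner)
  then have "(x \<circ> r) \<longlonglongrightarrow> P w" using Px[OF x] by (simp add: comp_def)
  then show ?thesis using that r PB by blast
qed

text \<open>Minimizing over coefficient vectors thus becomes minimizing over a finite-dimensional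
  subspace, whatever linear dependencies the generators have.\<close>

lemma range_lin_comb: "range (lin_comb u0 z n) = span (insert u0 (z ` {1..n}))"
proof
  show "range (lin_comb u0 z n) \<subseteq> span (insert u0 (z ` {1..n}))"
    unfolding lin_comb_def by (intro image_subsetI span_add span_sum span_scale span_base) auto
  have sub: "subspace (range (lin_comb u0 z n))"
  proof (rule subspaceI)
    have "lin_comb u0 z n (\<lambda>_. 0) = 0" by (simp add: lin_comb_def)
    then show "0 \<in> range (lin_comb u0 z n)" by (metis rangeI)
  next
    fix x y assume "x \<in> range (lin_comb u0 z n)" "y \<in> range (lin_comb u0 z n)"
    then obtain c e where "x = lin_comb u0 z n c" "y = lin_comb u0 z n e" by auto
    then have "x + y = lin_comb u0 z n (\<lambda>i. c i + e i)"
      by (simp add: lin_comb_def scaleR_add_left sum.distrib)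
    then show "x + y \<in> range (lin_comb u0 z n)" by simp
  next
    fix t x assume "x \<in> range (lin_comb u0 z n)"
    then obtain c where "x = lin_comb u0 z n c" by auto
    then have "t *\<^sub>R x = lin_comb u0 z n (\<lambda>i. t * c i)"
      by (simp add: lin_comb_def scaleR_add_right scaleR_sum_right)
    then show "t *\<^sub>R x \<in> range (lin_comb u0 z n)" by simp
  qed
  have "u0 = lin_comb u0 z n (\<lambda>i. if i = 0 then 1 else 0)"
    by (simp add: lin_comb_def)
  then have "u0 \<in> range (lin_comb u0 z n)" by (metis rangeI)
  moreover have "z i \<in> range (lin_comb u0 z n)" if i: "i \<in> {1..n}" for i
  proof -
    have "(\<Sum>j = 1..n. (if j = i then 1 else 0) *\<^sub>R z j) = (\<Sum>j = 1..n. if j = i then z j else 0)"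
      by (intro sum.cong) auto
    then have "z i = lin_comb u0 z n (\<lambda>j. if j = i then 1 else 0)"
      using i by (simp add: lin_comb_def)
    then show ?thesis by (metis rangeI)
  qed
  ultimately show "span (insert u0 (z ` {1..n})) \<subseteq> range (lin_comb u0 z n)"
    by (intro span_minimal sub) auto
qed

section \<open>Existence and optimality in the residual minimization\<close>

context embedded_form
begin

text \<open>The direct method: coercivity bounds a minimizing sequence, weak closedness keeps a weak
  limit in \<open>D\<close>, and convexity gives lower semicontinuity. The minimizer is a point of
  \<open>D\<close> nearest to \<open>- g\<close> in the energy norm.\<close>

lemma minimizer_on_weakly_closed:
  assumes sep: "separable_space (euclidean :: 'v topology)"
    and D: "closedin weak_topology D" "D \<noteq> {}"
  obtains z where "z \<in> D" "\<And>y. y \<in> D \<Longrightarrow> b (z + g) (z + g) \<le> b (y + g) (y + g)"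
proof -
  define J where "J z = b (z + g) (z + g)" for z
  define I where "I = (INF z\<in>D. J z)"
  have bdd: "bdd_below (J ` D)" by (rule bdd_belowI2[of _ 0]) (simp add: J_def b_nonneg)
  have I_le: "I \<le> J z" if "z \<in> D" for z unfolding I_def using bdd that by (rule cINF_lower)
  have "\<exists>x\<in>D. J x < I + 1 / real (Suc n)" for n
    using cInf_lessD[of "J ` D" "I + 1 / real (Suc n)"] D(2) unfolding I_def by auto
  then obtain x where xD: "\<And>n. x n \<in> D" and xJ: "\<And>n. J (x n) < I + 1 / real (Suc n)" by metis
  have "norm (x n) \<le> sqrt ((I + 1) / \<gamma>) + norm g" for n
  proof -
    have "1 / real (Suc n) \<le> 1" by simp
    then have "\<gamma> * (norm (x n + g))\<^sup>2 \<le> I + 1"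
      using b_coercive[of "x n + g"] xJ[of n] unfolding J_def by linarith
    then have "norm (x n + g) \<le> sqrt ((I + 1) / \<gamma>)"
      using gamma by (intro real_le_rsqrt) (simp add: field_simps)
    then show ?thesis using norm_triangle_ineq4[of "x n + g" g] by simp
  qed
  then have "bounded (range x)" by (auto simp: bounded_iff)
  then obtain r w where r: "strict_mono r" and w: "limitin weak_topology (x \<circ> r) w sequentially"
    by (rule bounded_sequence_weakly_convergent_subsequence[OF sep])
  have "w \<in> D"
    by (rule limitin_closedin[OF w D(1)]) (use xD in auto)
  \<comment> \<open>The tangent bound from \<open>b_nonneg\<close> stands in for weak lower
    semicontinuity: its left side is affine in \<open>x n\<close> and so passes to the weak
    limit.\<close>
  have low: "2 * b (w + g) (x n + g) - J w \<le> J (x n)" for n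
  proof -
    have "0 \<le> b ((x n + g) - (w + g)) ((x n + g) - (w + g))" by (rule b_nonneg)
    then show ?thesis using b_sym[of "x n + g" "w + g"]
      unfolding J_def b.diff_left[of "x n + g" "w + g"] b.diff_right by linarith
  qed
  have "(\<lambda>n. b (w + g) (x (r n))) \<longlonglongrightarrow> b (w + g) w"
    using limitin_weak_topology_functional[OF w b.bounded_linear_right] by simp
  then have "(\<lambda>n. 2 * (b (w + g) (x (r n)) + b (w + g) g) - J w) \<longlonglongrightarrow> 2 * (b (w + g) w + b (w + g) g) - J w"
    by (intro tendsto_intros)
  then have 1: "(\<lambda>n. 2 * b (w + g) (x (r n) + g) - J w) \<longlonglongrightarrow> J w"
    by (simp add: J_def b.add_right)
  have 2: "(\<lambda>n. I + 1 / real (Suc (r n))) \<longlonglongrightarrow> I + 0"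
    by (rule LIMSEQ_subseq_LIMSEQ[OF _ r, unfolded comp_def]) (intro tendsto_intros LIMSEQ_Suc lim_1_over_n)
  have "J w \<le> I + 0"
    using 1 2 by (rule LIMSEQ_le) (use low xJ in \<open>metis less_imp_le order_trans\<close>)
  then have "J w \<le> J y" if "y \<in> D" for y using I_le[OF that] by linarith
  with \<open>w \<in> D\<close> show ?thesis using that by (simp add: J_def)
qed

text \<open>As a functional of \<open>w\<close>, the weak form of \<open>A u - l u\<close>; it
  vanishes identically exactly when \<open>u\<close> solves the eigenvalue equation for
  \<open>l\<close>.\<close>

definition residual :: "'v \<Rightarrow> real \<Rightarrow> 'v \<Rightarrow> real" where
  "residual u l w = a u w - l * (\<iota> u \<bullet> \<iota> w)"

lemma bounded_linear_residual: "bounded_linear (residual u l)"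
proof -
  have "bounded_linear (\<lambda>w. \<iota> u \<bullet> \<iota> w)"
    by (rule bounded_linear_compose[OF bounded_linear_inner_right emb])
  from bounded_linear_sub[OF a.bounded_linear_right bounded_linear_const_mult[OF this]]
  show ?thesis by (simp add: residual_def[abs_def])
qed

lemma residual_objective:
  "1/2 * (energy_norm a \<iota> \<nu> (u + z))\<^sup>2 - (l + \<nu>) * (\<iota> u \<bullet> \<iota> z)
    = 1/2 * b z z + residual u l z + 1/2 * b u u"
proof -
  have "(energy_norm a \<iota> \<nu> (u + z))\<^sup>2 = b (u + z) (u + z)" using b_nonneg by (simp add: energy_norm_b)
  also have "\<dots> = b u u + 2 * b u z + b z z" using b_sym[of z u] by (simp add: b.add_left b.add_right)
  finally have "1/2 * (energy_norm a \<iota> \<nu> (u + z))\<^sup>2 = 1/2 * b u u + b u z + 1/2 * b z z" by simp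
  moreover have "b u z - (l + \<nu>) * (\<iota> u \<bullet> \<iota> z) = residual u l z"
    by (simp add: b_def residual_def algebra_simps)
  ultimately show ?thesis by linarith
qed

lemma residual_argmin_iff:
  "z \<in> residual_argmin a \<iota> \<nu> D u l \<longleftrightarrow>
     z \<in> D \<and> (\<forall>y\<in>D. 1/2 * b z z + residual u l z \<le> 1/2 * b y y + residual u l y)"
  unfolding residual_argmin_def is_arg_min_def residual_objective mem_Collect_eq
  by (auto simp: not_less)

text \<open>With \<open>g\<close> representing the residual through \<open>b\<close>, completing the
  square turns the objective, up to a factor and a constant, into
  \<open>b (z + g) (z + g)\<close>.\<close>

lemma residual_argmin_nonempty:
  assumes sep: "separable_space (euclidean :: 'v topology)" and D: "is_dictionary D"
  shows "residual_argmin a \<iota> \<nu> D u l \<noteq> {}"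
proof -
  obtain g where g: "\<And>w. b g w = residual u l w"
    using b_riesz[OF bounded_linear_residual] by blast
  have "closedin weak_topology D" "D \<noteq> {}" using D by (auto simp: is_dictionary_def)
  then obtain z where z: "z \<in> D" "\<And>y. y \<in> D \<Longrightarrow> b (z + g) (z + g) \<le> b (y + g) (y + g)"
    using minimizer_on_weakly_closed[OF sep] by blast
  have "b (y + g) (y + g) = 2 * (1/2 * b y y + residual u l y) + b g g" for y
    using b_sym[of y g] by (simp add: b.add_left b.add_right g)
  with z have "z \<in> residual_argmin a \<iota> \<nu> D u l"
    unfolding residual_argmin_iff by fastforce
  then show ?thesis by blast
qed

text \<open>Since \<open>D\<close> is a cone, all multiples of \<open>z\<close> and of any
  \<open>w\<close> in \<open>D\<close> compete. Stationarity along \<open>z\<close> gives the first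
  claim, which evaluates the minimum as \<open>- (1/2 * b z z)\<close>; the best multiple of
  \<open>w\<close> then gives the second.\<close>

lemma residual_argmin_optimality:
  assumes D: "is_dictionary D" and z: "z \<in> residual_argmin a \<iota> \<nu> D u l"
  shows "residual u l z = - b z z"
    and "\<And>w. w \<in> D \<Longrightarrow> (residual u l w)\<^sup>2 \<le> b w w * b z z"
proof -
  interpret f: bounded_linear "residual u l" by (rule bounded_linear_residual)
  have zD: "z \<in> D" and cone: "\<And>t w. w \<in> D \<Longrightarrow> t *\<^sub>R w \<in> D"
    using z D by (auto simp: residual_argmin_iff is_dictionary_def)
  have min: "1/2 * b z z + residual u l z \<le> 1/2 * t\<^sup>2 * b w w + t * residual u l w" if "w \<in> D" for w t
    using z cone[OF that, of t]
    by (auto simp: residual_argmin_iff b.scaleR_left b.scaleR_right f.scaleR power2_eq_square mult.assoc)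
  \<comment> \<open>The shift from \<open>t\<close> to \<open>1 + t\<close> places the minimum along
    the line through \<open>z\<close> at \<open>t = 0\<close>.\<close>
  have "0 \<le> t\<^sup>2 * (1/2 * b z z) + 2 * t * ((b z z + residual u l z) / 2)" for t
    using min[OF zD, of "1 + t"] by (simp add: power2_eq_square field_simps)
  from linear_coefficient_eq_0[OF this] show eq: "residual u l z = - b z z" by simp
  fix w assume w: "w \<in> D"
  show "(residual u l w)\<^sup>2 \<le> b w w * b z z"
  proof (cases "w = 0")
    case False
    then have p: "b w w > 0" using b_nonneg[of w] by (simp add: less_le)
    define q where "q = residual u l w"
    \<comment> \<open>The factor \<open>- q / b w w\<close> minimizes the objective along the line
      through \<open>w\<close>.\<close>
    have "- (1/2 * b z z) \<le> 1/2 * (- q / b w w)\<^sup>2 * b w w + (- q / b w w) * q"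
      using min[OF w, of "- q / b w w"] eq by (simp add: q_def)
    also have "\<dots> = - (1/2 * (q\<^sup>2 / b w w))" using p by (simp add: power2_eq_square field_simps)
    finally have "q\<^sup>2 / b w w \<le> b z z" by simp
    then show ?thesis using p by (simp add: q_def field_simps)
  qed (simp add: f.zero b.zero_left)
qed

lemma residual_self: "norm (\<iota> u) = 1 \<Longrightarrow> residual u (a u u) u = 0"
  by (simp add: residual_def power2_norm_eq_inner[symmetric])

text \<open>The multiplier is the Rayleigh quotient of \<open>u\<close>, so the residual vanishes at
  \<open>u\<close>. If \<open>z = - u\<close>, optimality then forces \<open>b z z = 0\<close>,
  against normalization. Thus the update can be normalized.\<close>

lemma residual_argmin_add_nonzero:
  assumes D: "is_dictionary D" and u: "norm (\<iota> u) = 1"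
    and z: "z \<in> residual_argmin a \<iota> \<nu> D u (a u u)"
  shows "u + z \<noteq> 0"
proof
  interpret f: bounded_linear "residual u (a u u)" by (rule bounded_linear_residual)
  assume "u + z = 0"
  then have zu: "z = - u" by (simp add: eq_neg_iff_add_eq_0 add.commute)
  then have "b z z = 0"
    using residual_argmin_optimality(1)[OF D z] residual_self[OF u] by (simp add: f.neg)
  with zu u show False by (simp add: \<iota>.zero)
qed

section \<open>Normalization and minimization of the Rayleigh quotient\<close>

lemma embed_eq_0_iff [simp]: "\<iota> v = 0 \<longleftrightarrow> v = 0"
  using injD[OF inj_emb, of v 0] by (auto simp: \<iota>.zero)

lemma norm_h_normalize: "v \<noteq> 0 \<Longrightarrow> norm (\<iota> (h_normalize \<iota> v)) = 1"
  by (simp add: h_normalize_def \<iota>.scaleR)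

lemma form_h_normalize: "a (h_normalize \<iota> v) (h_normalize \<iota> v) = a v v / (norm (\<iota> v))\<^sup>2"
  by (simp add: h_normalize_def a.scaleR_left a.scaleR_right power2_eq_square divide_inverse)

text \<open>After expansion and the identity \<open>residual u (a u u) z = - b z z\<close>, the
  right side equals \<open>b z z + (a u u + \<nu>) * (\<iota> z \<bullet> \<iota> z)\<close>, and
  \<open>a u u + \<nu> = b u u\<close> is nonnegative.\<close>

lemma rayleigh_decrease:
  assumes D: "is_dictionary D" and u: "norm (\<iota> u) = 1"
    and z: "z \<in> residual_argmin a \<iota> \<nu> D u (a u u)"
  shows "b z z \<le> (a u u - a (u + z) (u + z) / (norm (\<iota> (u + z)))\<^sup>2) * (norm (\<iota> (u + z)))\<^sup>2"
proof -
  have pos: "(norm (\<iota> (u + z)))\<^sup>2 > 0"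
    using residual_argmin_add_nonzero[OF assms] by simp
  have lb: "a u u + \<nu> \<ge> 0" using b_nonneg[of u] u by (simp add: b_def power2_norm_eq_inner[symmetric])
  have uu: "\<iota> u \<bullet> \<iota> u = 1" using u by (simp add: power2_norm_eq_inner[symmetric])
  have "residual u (a u u) z = - b z z" by (rule residual_argmin_optimality(1)[OF D z])
  then have "a u u * (norm (\<iota> (u + z)))\<^sup>2 - a (u + z) (u + z) = b z z + (a u u + \<nu>) * (\<iota> z \<bullet> \<iota> z)"
    using sym[of z u] uu
    by (simp add: residual_def b_def power2_norm_eq_inner a.add_left a.add_right \<iota>.add
        inner_add_left inner_add_right inner_commute algebra_simps)
  moreover have "(a u u + \<nu>) * (\<iota> z \<bullet> \<iota> z) \<ge> 0" using lb by simp
  ultimately show ?thesis using pos by (simp add: left_diff_distrib)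
qed

text \<open>A minimizing sequence on the H-unit sphere of the finite-dimensional span has a
  norm-convergent subsequence. Homogeneity transfers its limit from the sphere to all nonzero
  vectors, and the zero vector has quotient \<infinity>.\<close>

lemma rayleigh_argmin_nonempty:
  assumes sep: "separable_space (euclidean :: 'v topology)" and u0: "norm (\<iota> u0) = 1"
  shows "rayleigh_argmin a \<iota> u0 z n \<noteq> {}"
proof -
  define W where "W = span (insert u0 (z ` {1..n}))"
  define K where "K = {v \<in> W. norm (\<iota> v) = 1}"
  define I where "I = (INF v\<in>K. a v v)"
  have low: "- \<nu> \<le> a v v" if "v \<in> K" for v
    using b_nonneg[of v] that by (simp add: K_def b_def power2_norm_eq_inner[symmetric])
  have bdd: "bdd_below ((\<lambda>v. a v v) ` K)" using low by (rule bdd_belowI2)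
  have I_le: "I \<le> a v v" if "v \<in> K" for v unfolding I_def using bdd that by (rule cINF_lower)
  have u0W: "u0 \<in> W" by (simp add: W_def span_base)
  then have ne: "K \<noteq> {}" using u0 by (auto simp: K_def)
  have "\<exists>x\<in>K. a x x < I + 1 / real (Suc n)" for n
    using cInf_lessD[of "(\<lambda>v. a v v) ` K" "I + 1 / real (Suc n)"] ne unfolding I_def by auto
  then obtain x where xK: "\<And>n. x n \<in> K" and xI: "\<And>n. a (x n) (x n) < I + 1 / real (Suc n)" by metis
  have "norm (x n) \<le> sqrt ((I + 1 + \<nu>) / \<gamma>)" for n
  proof -
    have "1 / real (Suc n) \<le> 1" by simp
    moreover have "\<gamma> * (norm (x n))\<^sup>2 - \<nu> \<le> a (x n) (x n)"
      using lower[of "x n"] xK[of n] by (simp add: K_def)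
    ultimately have "\<gamma> * (norm (x n))\<^sup>2 \<le> I + 1 + \<nu>" using xI[of n] by linarith
    then show ?thesis using gamma by (intro real_le_rsqrt) (simp add: field_simps)
  qed
  then have "bounded (range x)" by (auto simp: bounded_iff)
  moreover have "finite (insert u0 (z ` {1..n}))" by simp
  moreover have "x k \<in> span (insert u0 (z ` {1..n}))" for k using xK by (auto simp: K_def W_def)
  ultimately obtain r w where r: "strict_mono r" and w: "(x \<circ> r) \<longlonglongrightarrow> w"
    and wW': "w \<in> span (insert u0 (z ` {1..n}))"
    by (rule bounded_sequence_in_finite_span[OF sep])
  have wW: "w \<in> W" using wW' by (simp add: W_def)
  have "(\<lambda>n. norm (\<iota> ((x \<circ> r) n))) \<longlonglongrightarrow> norm (\<iota> w)" by (intro tendsto_norm \<iota>.tendsto w)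
  then have nw: "norm (\<iota> w) = 1" using xK by (simp add: K_def LIMSEQ_const_iff)
  have "(\<lambda>n. a ((x \<circ> r) n) ((x \<circ> r) n)) \<longlonglongrightarrow> a w w" by (intro a.tendsto w)
  moreover have "(\<lambda>n. I + 1 / real (Suc (r n))) \<longlonglongrightarrow> I + 0"
    by (rule LIMSEQ_subseq_LIMSEQ[OF _ r, unfolded comp_def]) (intro tendsto_intros LIMSEQ_Suc lim_1_over_n)
  ultimately have "a w w \<le> I + 0"
    by (rule LIMSEQ_le) (use xI less_imp_le in auto)
  then have aw: "a w w \<le> I" by simp
  obtain c where c: "w = lin_comb u0 z n c" using wW range_lin_comb[of u0 z n] unfolding W_def by blast
  have "rayleigh a \<iota> w \<le> rayleigh a \<iota> v" if "v \<in> W" for v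
  proof (cases "v = 0")
    case False
    have "h_normalize \<iota> v \<in> W" using that unfolding W_def h_normalize_def by (rule span_scale)
    then have "I \<le> a v v / (norm (\<iota> v))\<^sup>2"
      using I_le[of "h_normalize \<iota> v"] norm_h_normalize[OF False] by (simp add: K_def form_h_normalize)
    moreover have "w \<noteq> 0" using nw by auto
    ultimately show ?thesis using False aw nw by (simp add: rayleigh_def)
  qed (simp add: rayleigh_def)
  then have "rayleigh a \<iota> (lin_comb u0 z n c) \<le> rayleigh a \<iota> (lin_comb u0 z n e)" for e
    unfolding c[symmetric] W_def range_lin_comb[symmetric] by simp
  then have "c \<in> rayleigh_argmin a \<iota> u0 z n"
    by (auto simp: rayleigh_argmin_def is_arg_min_def not_less)
  then show ?thesis by blast
qed

text \<open>A nonzero competitor has a finite quotient, which the value \<infinity> at zero cannot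
  match; so the minimizer is nonzero and the comparison becomes one of real numbers.\<close>

lemma rayleigh_argminD:
  assumes c: "c \<in> rayleigh_argmin a \<iota> u0 z n" and v: "v \<in> span (insert u0 (z ` {1..n}))" "v \<noteq> 0"
  shows "lin_comb u0 z n c \<noteq> 0"
    and "a (lin_comb u0 z n c) (lin_comb u0 z n c) / (norm (\<iota> (lin_comb u0 z n c)))\<^sup>2
      \<le> a v v / (norm (\<iota> v))\<^sup>2"
proof -
  obtain e where e: "v = lin_comb u0 z n e" using v(1) unfolding range_lin_comb[symmetric] by blast
  have le: "rayleigh a \<iota> (lin_comb u0 z n c) \<le> rayleigh a \<iota> v"
    using c by (auto simp: rayleigh_argmin_def is_arg_min_def not_less e)
  then show ne: "lin_comb u0 z n c \<noteq> 0" using v(2) by (auto simp: rayleigh_def)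
  from le show "a (lin_comb u0 z n c) (lin_comb u0 z n c) / (norm (\<iota> (lin_comb u0 z n c)))\<^sup>2
      \<le> a v v / (norm (\<iota> v))\<^sup>2"
    using v(2) ne by (simp add: rayleigh_def)
qed

end

section \<open>Convergence of the greedy algorithms\<close>

text \<open>A bootstrap: the bound \<open>d \<le> 1/4\<close> gives
  \<open>s \<le> (1 + s) / 2\<close>, hence \<open>s \<le> 1\<close>, and then
  \<open>(1 + s)\<^sup>2 \<le> 4\<close>. It is applied with \<open>s\<close> the energy norm of a
  correction and \<open>d\<close> the decrease of \<open>lam\<close>.\<close>

lemma le_of_square_le_mult_square:
  fixes s d :: real
  assumes "0 \<le> s" "d \<le> 1/4" "s\<^sup>2 \<le> d * (1 + s)\<^sup>2"
  shows "s\<^sup>2 \<le> 4 * d"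
proof -
  have "s\<^sup>2 \<le> (1/4) * (1 + s)\<^sup>2"
    using assms(2,3) by (meson mult_right_mono order_trans zero_le_power2)
  then have "s\<^sup>2 \<le> ((1 + s) / 2)\<^sup>2" by (simp add: power_divide)
  then have "s \<le> (1 + s) / 2" using assms(1) by (simp add: power2_le_iff_abs_le)
  then have s1: "s \<le> 1" by simp
  have "0 \<le> d * (1 + s)\<^sup>2" by (rule order_trans[OF zero_le_power2 assms(3)])
  then have "0 \<le> d" using assms(1) by (simp add: zero_le_mult_iff)
  moreover have "(1 + s)\<^sup>2 \<le> 2\<^sup>2" using assms(1) s1 by (intro power_mono) auto
  ultimately have "d * (1 + s)\<^sup>2 \<le> d * 4" by (intro mult_left_mono) auto
  with assms(3) show ?thesis by linarith
qed

text \<open>The common ground of both algorithms: whatever the update rule, \<open>improve\<close>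
  makes the new Rayleigh quotient at least as good as that of the pure update
  \<open>u n + z (Suc n)\<close>.\<close>

locale greedy_sequence = embedded_form +
  fixes D :: "'a set" and u z :: "nat \<Rightarrow> 'a" and lam :: "nat \<Rightarrow> real"
  assumes sep: "separable_space (euclidean :: 'a topology)"
    and dict: "is_dictionary D"
    and norm_u: "\<And>n. norm (\<iota> (u n)) = 1"
    and lam: "\<And>n. lam n = a (u n) (u n)"
    and z: "\<And>n. z (Suc n) \<in> residual_argmin a \<iota> \<nu> D (u n) (lam n)"
    and improve: "\<And>n. lam (Suc n) \<le> a (u n + z (Suc n)) (u n + z (Suc n)) / (norm (\<iota> (u n + z (Suc n))))\<^sup>2"
begin

section \<open>Monotone Rayleigh quotients and vanishing corrections\<close>

lemma b_u: "b (u n) (u n) = lam n + \<nu>"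
  using norm_u[of n] by (simp add: b_def lam power2_norm_eq_inner[symmetric])

lemma lam_ge: "1 \<le> lam n + \<nu>"
  using b_ge_inner[of "u n"] norm_u[of n] by (simp add: b_u power2_norm_eq_inner[symmetric])

lemma decrease:
  "b (z (Suc n)) (z (Suc n)) \<le> (lam n - lam (Suc n)) * (norm (\<iota> (u n + z (Suc n))))\<^sup>2"
proof -
  have "b (z (Suc n)) (z (Suc n))
      \<le> (lam n - a (u n + z (Suc n)) (u n + z (Suc n)) / (norm (\<iota> (u n + z (Suc n))))\<^sup>2)
        * (norm (\<iota> (u n + z (Suc n))))\<^sup>2"
    using rayleigh_decrease[OF dict norm_u, of "z (Suc n)" n] z[of n] by (simp add: lam)
  also have "\<dots> \<le> (lam n - lam (Suc n)) * (norm (\<iota> (u n + z (Suc n))))\<^sup>2"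
    using improve[of n] by (intro mult_right_mono) auto
  finally show ?thesis .
qed

lemma decseq_lam: "decseq lam"
proof (rule decseq_SucI)
  fix n
  have ne: "u n + z (Suc n) \<noteq> 0"
    using residual_argmin_add_nonzero[OF dict norm_u, of "z (Suc n)" n] z[of n] by (simp add: lam)
  have "0 \<le> (lam n - lam (Suc n)) * (norm (\<iota> (u n + z (Suc n))))\<^sup>2"
    using decrease[of n] b_nonneg order_trans by blast
  then show "lam (Suc n) \<le> lam n" using ne by (simp add: zero_le_mult_iff)
qed

definition "l = lim lam"

lemma lam_lim: "lam \<longlonglongrightarrow> l"
proof -
  have "\<forall>n. 1 - \<nu> \<le> lam n" using lam_ge by (simp add: diff_le_eq)
  from decseq_convergent[OF decseq_lam this] have "convergent lam" unfolding convergent_def by blast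
  then show ?thesis by (simp add: l_def convergent_LIMSEQ_iff)
qed

lemma l_le: "l \<le> lam n"
  by (rule decseq_ge[OF decseq_lam lam_lim])

lemma l_ge: "1 \<le> l + \<nu>"
proof -
  have "1 - \<nu> \<le> l"
    by (rule LIMSEQ_le_const[OF lam_lim]) (use lam_ge in \<open>auto simp: algebra_simps\<close>)
  then show ?thesis by simp
qed

lemma bounded_u: "bounded (range u)"
proof -
  have "norm (u n) \<le> sqrt ((lam 0 + \<nu>) / \<gamma>)" for n
  proof -
    have "\<gamma> * (norm (u n))\<^sup>2 \<le> lam 0 + \<nu>"
      using b_coercive[of "u n"] decseqD[OF decseq_lam, of 0 n] by (simp add: b_u)
    then show ?thesis using gamma by (intro real_le_rsqrt) (simp add: field_simps)
  qed
  then show ?thesis by (auto simp: bounded_iff)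
qed

lemma norm_z_bound:
  "norm (\<iota> (z (Suc n))) \<le> sqrt (b (z (Suc n)) (z (Suc n)))"
  using b_ge_inner[of "z (Suc n)"] by (intro real_le_rsqrt) (simp add: power2_norm_eq_inner)

lemma z_lim: "(\<lambda>n. b (z (Suc n)) (z (Suc n))) \<longlonglongrightarrow> 0"
proof -
  have dl: "(\<lambda>n. lam n - lam (Suc n)) \<longlonglongrightarrow> l - l"
    by (intro tendsto_diff lam_lim LIMSEQ_Suc)
  \<comment> \<open>The threshold \<open>1/4\<close> is the one required by
    \<open>le_of_square_le_mult_square\<close>.\<close>
  then have "\<forall>\<^sub>F n in sequentially. lam n - lam (Suc n) < 1/4"
    by (intro order_tendstoD(2)[where y = "l - l"]) auto
  then have ev: "\<forall>\<^sub>F n in sequentially. norm (b (z (Suc n)) (z (Suc n))) \<le> 4 * (lam n - lam (Suc n))"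
  proof eventually_elim
    case (elim n)
    define s where "s = sqrt (b (z (Suc n)) (z (Suc n)))"
    have s: "0 \<le> s" "s\<^sup>2 = b (z (Suc n)) (z (Suc n))" using b_nonneg by (auto simp: s_def)
    have "norm (\<iota> (u n + z (Suc n))) \<le> 1 + s"
      using norm_triangle_ineq[of "\<iota> (u n)" "\<iota> (z (Suc n))"] norm_u[of n] norm_z_bound[of n]
      by (simp add: \<iota>.add s_def)
    then have "(norm (\<iota> (u n + z (Suc n))))\<^sup>2 \<le> (1 + s)\<^sup>2" by (intro power_mono) auto
    moreover have "0 \<le> lam n - lam (Suc n)" using decseqD[OF decseq_lam, of n "Suc n"] by simp
    ultimately have "s\<^sup>2 \<le> (lam n - lam (Suc n)) * (1 + s)\<^sup>2"
      using decrease[of n] unfolding s(2) by (meson mult_left_mono order_trans)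
    then have "s\<^sup>2 \<le> 4 * (lam n - lam (Suc n))"
      using elim s by (intro le_of_square_le_mult_square) auto
    then show ?case using b_nonneg[of "z (Suc n)"] by (simp add: s(2))
  qed
  have "(\<lambda>n. 4 * (lam n - lam (Suc n))) \<longlonglongrightarrow> 0"
    using tendsto_mult_right_zero[of "\<lambda>n. lam n - lam (Suc n)" sequentially 4] dl by simp
  with ev show ?thesis by (rule Lim_null_comparison)
qed

text \<open>On the dictionary, optimality bounds the residual by a multiple of the energy norm of
  the next correction. The vectors with vanishing residual limit form a subspace, and the uniform
  bound \<open>C\<close> extends the limit from the dense span to all of V.\<close>

lemma residual_lim: "(\<lambda>n. residual (u n) (lam n) v) \<longlonglongrightarrow> 0"
proof -
  have lin: "bounded_linear (residual (u n) (lam n))" for n by (rule bounded_linear_residual)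
  define E where "E = {v. (\<lambda>n. residual (u n) (lam n) v) \<longlonglongrightarrow> 0}"
  obtain U where U: "U > 0" "\<And>n. norm (u n) \<le> U" using bounded_u by (auto simp: bounded_pos)
  obtain K where K: "K > 0" "\<And>v w. norm (a v w) \<le> norm v * norm w * K" using a.pos_bounded by blast
  obtain K' where K': "K' > 0" "\<And>v. norm (\<iota> v) \<le> norm v * K'" using \<iota>.pos_bounded by blast
  \<comment> \<open>Monotonicity bounds \<open>lam n\<close> above by \<open>lam 0\<close>, and
    \<open>lam_ge\<close> bounds it below by \<open>1 - \<nu>\<close>.\<close>
  define L where "L = \<bar>lam 0\<bar> + \<nu>"
  have L: "\<bar>lam n\<bar> \<le> L" for n
    using decseqD[OF decseq_lam, of 0 n] lam_ge[of n] nu unfolding L_def by linarith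
  define C where "C = U * K + L * K'"
  have C: "C > 0" using U K K' nu by (simp add: C_def L_def add_pos_nonneg)
  have est: "\<bar>residual (u n) (lam n) v\<bar> \<le> C * norm v" for n v
  proof -
    have "norm (u n) * norm v * K \<le> U * norm v * K"
      using U(2)[of n] K(1) by (intro mult_right_mono) auto
    then have "\<bar>a (u n) v\<bar> \<le> U * norm v * K" using K(2)[of "u n" v] by simp
    moreover have "\<bar>lam n * (\<iota> (u n) \<bullet> \<iota> v)\<bar> \<le> L * (norm v * K')"
    proof -
      have "\<bar>\<iota> (u n) \<bullet> \<iota> v\<bar> \<le> norm v * K'"
        using Cauchy_Schwarz_ineq2[of "\<iota> (u n)" "\<iota> v"] K'(2)[of v] norm_u[of n] by simp
      then show ?thesis unfolding abs_mult using L[of n] by (intro mult_mono) auto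
    qed
    ultimately have "\<bar>residual (u n) (lam n) v\<bar> \<le> U * norm v * K + L * (norm v * K')"
      unfolding residual_def by linarith
    then show ?thesis by (simp add: C_def algebra_simps)
  qed
  have "subspace E"
  proof (rule subspaceI)
    show "0 \<in> E" by (simp add: E_def linear_0[OF bounded_linear.linear[OF lin]])
    show "x + y \<in> E" if "x \<in> E" "y \<in> E" for x y
    proof -
      have "(\<lambda>n. residual (u n) (lam n) x + residual (u n) (lam n) y) \<longlonglongrightarrow> 0 + 0"
        using that by (intro tendsto_add) (simp_all add: E_def)
      then show ?thesis by (simp add: E_def linear_add[OF bounded_linear.linear[OF lin]])
    qed
    show "c *\<^sub>R x \<in> E" if "x \<in> E" for c x
      using that by (simp add: E_def linear_scale[OF bounded_linear.linear[OF lin]] tendsto_mult_right_zero)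
  qed
  moreover have "D \<subseteq> E"
  proof
    fix w assume w: "w \<in> D"
    have "norm (residual (u n) (lam n) w) \<le> sqrt (b w w * b (z (Suc n)) (z (Suc n)))" for n
      using residual_argmin_optimality(2)[OF dict z w, of n] by (intro real_le_rsqrt) simp
    then have "\<forall>\<^sub>F n in sequentially. norm (residual (u n) (lam n) w) \<le> sqrt (b w w * b (z (Suc n)) (z (Suc n)))"
      by simp
    moreover have "(\<lambda>n. sqrt (b w w * b (z (Suc n)) (z (Suc n)))) \<longlonglongrightarrow> sqrt (b w w * 0)"
      by (intro tendsto_real_sqrt tendsto_mult tendsto_const z_lim)
    ultimately show "w \<in> E" unfolding E_def mem_Collect_eq mult_zero_right real_sqrt_zero
      by (rule Lim_null_comparison)
  qed
  ultimately have sp: "span D \<subseteq> E" by (intro span_minimal)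
  show ?thesis
  proof (rule LIMSEQ_I)
    fix e :: real assume e: "e > 0"
    have "v \<in> closure (span D)" using dict by (simp add: is_dictionary_def)
    then obtain y where y: "y \<in> span D" "dist y v < e / (2 * C)"
      unfolding closure_approachable using e C by (meson divide_pos_pos mult_pos_pos zero_less_numeral)
    then have "(\<lambda>n. residual (u n) (lam n) y) \<longlonglongrightarrow> 0" using sp by (auto simp: E_def)
    then obtain N where N: "\<And>n. n \<ge> N \<Longrightarrow> \<bar>residual (u n) (lam n) y\<bar> < e / 2"
      using LIMSEQ_D[of "\<lambda>n. residual (u n) (lam n) y" 0 "e/2"] e by auto
    have "norm (residual (u n) (lam n) v - 0) < e" if "n \<ge> N" for n
    proof -
      have "residual (u n) (lam n) v = residual (u n) (lam n) y + residual (u n) (lam n) (v - y)"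
        using linear_diff[OF bounded_linear.linear[OF lin]] by simp
      moreover have "\<bar>residual (u n) (lam n) (v - y)\<bar> < e / 2"
      proof -
        have "C * norm (v - y) < C * (e / (2 * C))"
          using y(2) C by (intro mult_strict_left_mono) (simp_all add: dist_norm norm_minus_commute)
        then show ?thesis using est[of n "v - y"] C by simp
      qed
      ultimately show ?thesis using N[OF that] by simp
    qed
    then show "\<exists>N. \<forall>n\<ge>N. norm (residual (u n) (lam n) v - 0) < e" by blast
  qed
qed

section \<open>Limits of the iterates below the essential spectrum\<close>

context
  assumes ess: "ereal (lam 0) < spectral_min (essential_spectrum G)"
begin

lemma l_ess: "ereal l < spectral_min (essential_spectrum G)"
  by (rule le_less_trans[OF _ ess]) (use l_le in simp)

lemma weak_limit:
  assumes r: "strict_mono r" and w: "limitin weak_topology (u \<circ> r) w sequentially"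
  shows "w \<in> normalized_eigenvectors a \<iota> l" "(u \<circ> r) \<longlonglongrightarrow> w"
proof -
  have lamr: "(\<lambda>n. lam (r n)) \<longlonglongrightarrow> l"
    using LIMSEQ_subseq_LIMSEQ[OF lam_lim r] by (simp add: comp_def)
  have eigen: "a w v = l * (\<iota> w \<bullet> \<iota> v)" for v
  proof -
    have "bounded_linear (\<lambda>x. \<iota> x \<bullet> \<iota> v)"
      by (rule bounded_linear_compose[OF bounded_linear_inner_left emb])
    from limitin_weak_topology_functional[OF w this]
      limitin_weak_topology_functional[OF w a.bounded_linear_left]
    have "(\<lambda>n. \<iota> (u (r n)) \<bullet> \<iota> v) \<longlonglongrightarrow> \<iota> w \<bullet> \<iota> v" "(\<lambda>n. a (u (r n)) v) \<longlonglongrightarrow> a w v" by simp_all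
    then have "(\<lambda>n. residual (u (r n)) (lam (r n)) v) \<longlonglongrightarrow> a w v - l * (\<iota> w \<bullet> \<iota> v)"
      unfolding residual_def by (intro tendsto_diff tendsto_mult lamr)
    moreover have "(\<lambda>n. residual (u (r n)) (lam (r n)) v) \<longlonglongrightarrow> 0"
      using LIMSEQ_subseq_LIMSEQ[OF residual_lim r] by (simp add: comp_def)
    ultimately show ?thesis using LIMSEQ_unique by fastforce
  qed
  define d where "d n = u (r n) - w" for n
  have d: "weakly_null d"
  proof -
    have "bounded (range (\<lambda>n. u (r n)))" using bounded_u by (rule bounded_subset) auto
    moreover have "bounded (range (\<lambda>n::nat. w))" by simp
    ultimately have "bounded (range d)" unfolding d_def[abs_def] by (rule bounded_minus_comp)
    moreover have "(\<lambda>n. d n \<bullet> v) \<longlonglongrightarrow> 0" for v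
      using w unfolding limitin_weak_topology_inner d_def inner_diff_left
      by (simp add: LIM_zero)
    ultimately show ?thesis by (simp add: weakly_null_def)
  qed
  \<comment> \<open>The eigenvalue equation for \<open>w\<close>, tested with \<open>u (r n)\<close>
    and with \<open>w\<close>, cancels every term except \<open>lam (r n) - l\<close>.\<close>
  have form: "b (d n) (d n) - (l + \<nu>) * (\<iota> (d n) \<bullet> \<iota> (d n)) = lam (r n) - l" for n
  proof -
    have uu: "\<iota> (u (r n)) \<bullet> \<iota> (u (r n)) = 1" using norm_u[of "r n"] by (simp add: power2_norm_eq_inner[symmetric])
    have "b (d n) (d n) - (l + \<nu>) * (\<iota> (d n) \<bullet> \<iota> (d n)) = a (d n) (d n) - l * (\<iota> (d n) \<bullet> \<iota> (d n))"
      by (simp add: b_def algebra_simps)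
    also have "\<dots> = lam (r n) - 2 * a w (u (r n)) + a w w
        - l * (1 - 2 * (\<iota> w \<bullet> \<iota> (u (r n))) + \<iota> w \<bullet> \<iota> w)"
      using sym[of "u (r n)" w] uu inner_commute[of "\<iota> w" "\<iota> (u (r n))"]
      by (simp add: d_def a.diff_left a.diff_right \<iota>.diff inner_diff_left inner_diff_right lam)
    also have "\<dots> = lam (r n) - l" by (simp add: eigen algebra_simps)
    finally show ?thesis .
  qed
  have "d \<longlonglongrightarrow> 0"
  proof (rule weakly_null_strong[OF d])
    show "0 < l + \<nu>" using l_ge by simp
    show "ereal (l + \<nu> - \<nu>) < spectral_min (essential_spectrum G)" using l_ess by simp
    show "(\<lambda>n. b (d n) (d n) - (l + \<nu>) * (\<iota> (d n) \<bullet> \<iota> (d n))) \<longlonglongrightarrow> 0"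
      unfolding form using lamr by (simp add: LIM_zero)
  qed
  then show conv: "(u \<circ> r) \<longlonglongrightarrow> w" by (simp add: d_def[abs_def] LIM_zero_iff comp_def)
  \<comment> \<open>Normalization of the limit is read off only after strong convergence, since a
    weak limit alone could lose norm.\<close>
  have "(\<lambda>n. norm (\<iota> ((u \<circ> r) n))) \<longlonglongrightarrow> norm (\<iota> w)" by (intro tendsto_norm \<iota>.tendsto conv)
  then have "norm (\<iota> w) = 1" by (simp add: norm_u LIMSEQ_const_iff)
  then show "w \<in> normalized_eigenvectors a \<iota> l"
    using eigen by (auto simp: normalized_eigenvectors_def form_eigenspace_def)
qed

text \<open>Otherwise some subsequence stays away from all normalized eigenvectors; a weakly
  convergent further subsequence contradicts \<open>weak_limit\<close>.\<close>

lemma near_eigenvectors: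
  assumes e: "e > 0"
  shows "\<forall>\<^sub>F n in sequentially. \<exists>w\<in>normalized_eigenvectors a \<iota> l. norm (u n - w) < e"
proof (rule ccontr)
  assume "\<not> ?thesis"
  then have "\<exists>\<^sub>F n in sequentially. \<not> (\<exists>w\<in>normalized_eigenvectors a \<iota> l. norm (u n - w) < e)"
    by (simp add: frequently_def)
  then have "infinite {n. \<not> (\<exists>w\<in>normalized_eigenvectors a \<iota> l. norm (u n - w) < e)}"
    by (simp add: cofinite_eq_sequentially[symmetric] frequently_cofinite)
  from infinite_enumerate[OF this] obtain r :: "nat \<Rightarrow> nat" where r: "strict_mono r"
    and mem: "\<forall>n. r n \<in> {n. \<not> (\<exists>w\<in>normalized_eigenvectors a \<iota> l. norm (u n - w) < e)}"
    by blast
  then have far: "\<not> norm (u (r n) - w) < e" if "w \<in> normalized_eigenvectors a \<iota> l" for n w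
    using that by blast
  have "bounded (range (u \<circ> r))" using bounded_u by (rule bounded_subset) auto
  then obtain s w where s: "strict_mono s" and w: "limitin weak_topology ((u \<circ> r) \<circ> s) w sequentially"
    by (rule bounded_sequence_weakly_convergent_subsequence[OF sep])
  have rs: "strict_mono (r \<circ> s)" using r s by (simp add: strict_mono_def)
  have w': "limitin weak_topology (u \<circ> (r \<circ> s)) w sequentially" using w by (simp add: comp_assoc)
  obtain N where "norm ((u \<circ> (r \<circ> s)) N - w) < e"
    using LIMSEQ_D[OF weak_limit(2)[OF rs w'] e] by blast
  with far[OF weak_limit(1)[OF rs w'], of "s N"] show False by simp
qed

lemma eigenvector_exists: "normalized_eigenvectors a \<iota> l \<noteq> {}"
  using eventually_happens[OF near_eigenvectors[OF zero_less_one]] by auto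

lemma energy_distance_lim:
  "(\<lambda>n. INF w\<in>normalized_eigenvectors a \<iota> l. energy_norm a \<iota> \<nu> (w - u n)) \<longlonglongrightarrow> 0"
proof (rule LIMSEQ_I)
  fix e :: real assume e: "e > 0"
  obtain K where K: "K > 0" "\<And>v w. norm (b v w) \<le> norm v * norm w * K" using b.pos_bounded by blast
  have bound: "energy_norm a \<iota> \<nu> v \<le> norm v * sqrt K" for v
  proof -
    have "b v v \<le> (norm v * sqrt K)\<^sup>2"
      using K(2)[of v v] K(1) unfolding power_mult_distrib by (simp add: power2_eq_square)
    then show ?thesis unfolding energy_norm_b using K(1) by (intro real_le_lsqrt) auto
  qed
  have nonneg: "0 \<le> energy_norm a \<iota> \<nu> v" for v by (simp add: energy_norm_b b_nonneg)
  have sK: "sqrt K > 0" using K by simp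
  then have "e / sqrt K > 0" using e by simp
  from near_eigenvectors[OF this] obtain N where
    N: "\<And>n. n \<ge> N \<Longrightarrow> \<exists>w\<in>normalized_eigenvectors a \<iota> l. norm (u n - w) < e / sqrt K"
    by (auto simp: eventually_sequentially)
  have "norm ((INF w\<in>normalized_eigenvectors a \<iota> l. energy_norm a \<iota> \<nu> (w - u n)) - 0) < e" if n: "n \<ge> N" for n
  proof -
    obtain w where w: "w \<in> normalized_eigenvectors a \<iota> l" "norm (u n - w) < e / sqrt K"
      using N[OF n] by blast
    have "(INF w\<in>normalized_eigenvectors a \<iota> l. energy_norm a \<iota> \<nu> (w - u n)) \<le> energy_norm a \<iota> \<nu> (w - u n)"
      by (intro cINF_lower w bdd_belowI2[of _ 0] nonneg)
    also have "\<dots> \<le> norm (u n - w) * sqrt K" using bound[of "w - u n"] by (simp add: norm_minus_commute)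
    also have "\<dots> < e" using w(2) sK by (simp add: field_simps)
    finally have "(INF w\<in>normalized_eigenvectors a \<iota> l. energy_norm a \<iota> \<nu> (w - u n)) < e" .
    \<comment> \<open>Nonemptiness from \<open>eigenvector_exists\<close> matters here, as a real
      infimum over the empty set has no such bound.\<close>
    moreover have "0 \<le> (INF w\<in>normalized_eigenvectors a \<iota> l. energy_norm a \<iota> \<nu> (w - u n))"
      by (intro cINF_greatest eigenvector_exists nonneg)
    ultimately show ?thesis by simp
  qed
  then show "\<exists>N. \<forall>n\<ge>N. norm ((INF w\<in>normalized_eigenvectors a \<iota> l. energy_norm a \<iota> \<nu> (w - u n)) - 0) < e"
    by blast
qed

section \<open>Convergence of the whole sequence for a simple eigenvalue\<close>

text \<open>The eigenspace lies in a line, and H-normalization fixes the coefficient up to sign. As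
  \<open>dim\<close> is \<open>0\<close> for infinite-dimensional spaces, the value \<open>1\<close>
  does mean a line.\<close>

lemma simple_eigenvectors:
  assumes dim: "dim (form_eigenspace a \<iota> l) = 1"
    and w: "w \<in> normalized_eigenvectors a \<iota> l" and w': "w' \<in> normalized_eigenvectors a \<iota> l"
  shows "w' = w \<or> w' = - w"
proof -
  obtain B where B: "form_eigenspace a \<iota> l \<subseteq> span B" "card B = 1"
    using basis_exists[of "form_eigenspace a \<iota> l"] dim by metis
  then obtain p where "B = {p}" by (auto simp: card_1_singleton_iff)
  then obtain s t where st: "w = s *\<^sub>R p" "w' = t *\<^sub>R p"
    using B(1) w w' by (force simp: normalized_eigenvectors_def span_singleton)
  then have "\<bar>s\<bar> * norm (\<iota> p) = 1" "\<bar>t\<bar> * norm (\<iota> p) = 1"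
    using w w' by (simp_all add: normalized_eigenvectors_def \<iota>.scaleR)
  then have "\<bar>s\<bar> = \<bar>t\<bar>" by (metis mult_cancel_right zero_neq_one mult_zero_right)
  then show ?thesis using st by (auto simp: abs_eq_iff)
qed

text \<open>The iterates approach the pair \<open>w\<close>, \<open>- w\<close>. Eventual
  nonnegativity of the inner products of consecutive iterates prevents a jump from one to the
  other.\<close>

lemma simple_convergence:
  assumes dim: "dim (form_eigenspace a \<iota> l) = 1"
    and acute: "\<forall>\<^sub>F n in sequentially. 0 \<le> \<iota> (u n) \<bullet> \<iota> (u (Suc n))"
  shows "\<exists>w\<in>normalized_eigenvectors a \<iota> l. u \<longlonglongrightarrow> w"
proof -
  let ?F = "normalized_eigenvectors a \<iota> l"
  obtain K where K: "K > 0" "\<And>v. norm (\<iota> v) \<le> norm v * K" using \<iota>.pos_bounded by blast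
  \<comment> \<open>Within this radius in V the H-distance is below \<open>1/2\<close>.\<close>
  define e0 where "e0 = 1 / (2 * K)"
  have e0: "e0 > 0" using K by (simp add: e0_def)
  have small: "norm (\<iota> v) < 1/2" if "norm v < e0" for v
  proof -
    have "norm v * K < e0 * K" using that K(1) by simp
    moreover have "e0 * K = 1/2" using K(1) by (simp add: e0_def)
    ultimately show ?thesis using K(2)[of v] by linarith
  qed
  have "\<forall>\<^sub>F n in sequentially. (\<exists>w\<in>?F. norm (u n - w) < e0) \<and> 0 \<le> \<iota> (u n) \<bullet> \<iota> (u (Suc n))"
    using near_eigenvectors[OF e0] acute by (rule eventually_conj)
  then obtain N where N: "\<And>n. n \<ge> N \<Longrightarrow> \<exists>w\<in>?F. norm (u n - w) < e0"
    and acuteN: "\<And>n. n \<ge> N \<Longrightarrow> 0 \<le> \<iota> (u n) \<bullet> \<iota> (u (Suc n))"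
    by (auto simp: eventually_sequentially)
  obtain w where w: "w \<in> ?F" and wN: "norm (u N - w) < e0" using N by blast
  have nw: "norm (\<iota> w) = 1" using w by (simp add: normalized_eigenvectors_def)
  have near: "norm (u n - w) < e0" if "n \<ge> N" for n
    using that
  proof (induction n rule: dec_induct)
    case base
    show ?case by (rule wN)
  next
    case (step n)
    obtain w' where w': "w' \<in> ?F" "norm (u (Suc n) - w') < e0" using N[of "Suc n"] step(1) by auto
    \<comment> \<open>A jump from \<open>w\<close> to \<open>- w\<close> would make the sum of two
      consecutive iterates shorter than \<open>1\<close> in H, while \<open>acute\<close> makes its
      square at least \<open>2\<close>.\<close>
    have "w' \<noteq> - w"
    proof
      assume "w' = - w"
      then have "norm (\<iota> (u n - w)) < 1/2" "norm (\<iota> (u (Suc n) + w)) < 1/2"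
        using small[OF step.IH] small[OF w'(2)] by simp_all
      moreover have "\<iota> (u n) + \<iota> (u (Suc n)) = \<iota> (u n - w) + \<iota> (u (Suc n) + w)"
        by (simp add: \<iota>.add \<iota>.diff)
      ultimately have "norm (\<iota> (u n) + \<iota> (u (Suc n))) < 1"
        using norm_triangle_ineq[of "\<iota> (u n - w)" "\<iota> (u (Suc n) + w)"] by simp
      then have "(norm (\<iota> (u n) + \<iota> (u (Suc n))))\<^sup>2 < 1" by (simp add: abs_square_less_1)
      moreover have "(norm (\<iota> (u n) + \<iota> (u (Suc n))))\<^sup>2 = 2 + 2 * (\<iota> (u n) \<bullet> \<iota> (u (Suc n)))"
        using norm_u[of n] norm_u[of "Suc n"] dot_norm[of "\<iota> (u n)" "\<iota> (u (Suc n))"] by simp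
      ultimately show False using acuteN[OF step(1)] by simp
    qed
    with simple_eigenvectors[OF dim w w'(1)] w'(2) show ?case by auto
  qed
  have "u \<longlonglongrightarrow> w"
  proof (rule LIMSEQ_I)
    fix e :: real assume e: "e > 0"
    have "min e e0 > 0" using e e0 by simp
    from near_eigenvectors[OF this] obtain M where
      M: "\<And>n. n \<ge> M \<Longrightarrow> \<exists>w\<in>?F. norm (u n - w) < min e e0" by (auto simp: eventually_sequentially)
    have "norm (u n - w) < e" if n: "n \<ge> max M N" for n
    proof -
      obtain w' where w': "w' \<in> ?F" "norm (u n - w') < min e e0" using M[of n] n by auto
      \<comment> \<open>A point within \<open>1/2\<close> of both \<open>w\<close> and
        \<open>- w\<close> in H would give \<open>norm (2 *\<^sub>R \<iota> w) < 1\<close>, whereas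
        this norm is \<open>2\<close>.\<close>
      have "w' \<noteq> - w"
      proof
        assume "w' = - w"
        then have "norm (\<iota> (u n - w)) < 1/2" "norm (\<iota> (u n + w)) < 1/2"
          using small[of "u n - w"] near[of n] n small[of "u n + w"] w'(2) by simp_all
        moreover have "\<iota> (u n + w) - \<iota> (u n - w) = 2 *\<^sub>R \<iota> w"
          by (simp add: \<iota>.add \<iota>.diff scaleR_2)
        ultimately have "norm (2 *\<^sub>R \<iota> w) < 1"
          using norm_triangle_ineq4[of "\<iota> (u n + w)" "\<iota> (u n - w)"] by simp
        then show False using nw by simp
      qed
      with simple_eigenvectors[OF dim w w'(1)] w'(2) show ?thesis by auto
    qed
    then show "\<exists>M. \<forall>n\<ge>M. norm (u n - w) < e" by blast
  qed
  with w show ?thesis by blast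
qed

end

end

section \<open>Verification of the abstract assumptions for both algorithms\<close>

context embedded_form
begin

lemma prega_step_properties:
  assumes D: "is_dictionary D" and u: "norm (\<iota> (u n)) = 1" and lam: "lam n = a (u n) (u n)"
    and step: "prega_step a \<iota> \<nu> D u z lam n"
  shows "norm (\<iota> (u (Suc n))) = 1"
    and "a (u (Suc n)) (u (Suc n)) = a (u n + z (Suc n)) (u n + z (Suc n)) / (norm (\<iota> (u n + z (Suc n))))\<^sup>2"
proof -
  have z: "z (Suc n) \<in> residual_argmin a \<iota> \<nu> D (u n) (a (u n) (u n))"
    and u': "u (Suc n) = h_normalize \<iota> (u n + z (Suc n))"
    using step by (auto simp: prega_step_def lam)
  have "u n + z (Suc n) \<noteq> 0" by (rule residual_argmin_add_nonzero[OF D u z])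
  then show "norm (\<iota> (u (Suc n))) = 1" unfolding u' by (rule norm_h_normalize)
  show "a (u (Suc n)) (u (Suc n)) = a (u n + z (Suc n)) (u n + z (Suc n)) / (norm (\<iota> (u n + z (Suc n))))\<^sup>2"
    unfolding u' by (rule form_h_normalize)
qed

text \<open>Because \<open>u n\<close> is in the span of the earlier generators, the pure update
  \<open>u n + z (Suc n)\<close> competes in the Rayleigh minimization. The sign rule gives the last
  claim and does not affect the quadratic form.\<close>

lemma orega_step_properties:
  assumes D: "is_dictionary D" and u: "norm (\<iota> (u n)) = 1" and lam: "lam n = a (u n) (u n)"
    and span: "u n \<in> span (insert (u 0) (z ` {1..n}))"
    and step: "orega_step a \<iota> \<nu> D u z lam n"
  shows "norm (\<iota> (u (Suc n))) = 1"
    and "u (Suc n) \<in> span (insert (u 0) (z ` {1..Suc n}))"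
    and "a (u (Suc n)) (u (Suc n)) \<le> a (u n + z (Suc n)) (u n + z (Suc n)) / (norm (\<iota> (u n + z (Suc n))))\<^sup>2"
    and "0 \<le> \<iota> (u n) \<bullet> \<iota> (u (Suc n))"
proof -
  have z: "z (Suc n) \<in> residual_argmin a \<iota> \<nu> D (u n) (a (u n) (u n))"
    using step by (auto simp: orega_step_def lam)
  obtain c where c: "c \<in> rayleigh_argmin a \<iota> (u 0) z (Suc n)"
    and u': "u (Suc n) = (let v = h_normalize \<iota> (lin_comb (u 0) z (Suc n) c)
       in if \<iota> (u n) \<bullet> \<iota> v \<le> 0 then - v else v)"
    using step by (auto simp: orega_step_def Let_def)
  define x where "x = lin_comb (u 0) z (Suc n) c"
  define v where "v = h_normalize \<iota> x"
  have u': "u (Suc n) = (if \<iota> (u n) \<bullet> \<iota> v \<le> 0 then - v else v)"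
    unfolding u' v_def x_def Let_def ..
  have ne: "u n + z (Suc n) \<noteq> 0" by (rule residual_argmin_add_nonzero[OF D u z])
  have "u n \<in> span (insert (u 0) (z ` {1..Suc n}))"
    by (rule subsetD[OF span_mono span]) auto
  moreover have "z (Suc n) \<in> span (insert (u 0) (z ` {1..Suc n}))" by (intro span_base) auto
  ultimately have mem: "u n + z (Suc n) \<in> span (insert (u 0) (z ` {1..Suc n}))" by (rule span_add)
  note opt = rayleigh_argminD[OF c mem ne, folded x_def]
  have nv: "norm (\<iota> v) = 1" unfolding v_def by (rule norm_h_normalize[OF opt(1)])
  then show "norm (\<iota> (u (Suc n))) = 1" by (simp add: u' \<iota>.neg)
  have "x \<in> span (insert (u 0) (z ` {1..Suc n}))"
    unfolding x_def range_lin_comb[symmetric] by simp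
  then have "v \<in> span (insert (u 0) (z ` {1..Suc n}))"
    unfolding v_def h_normalize_def by (rule span_scale)
  then show "u (Suc n) \<in> span (insert (u 0) (z ` {1..Suc n}))"
    by (simp add: u' span_neg del: atLeastAtMost_iff image_insert)
  have "a (u (Suc n)) (u (Suc n)) = a v v"
    by (simp add: u' a.minus_left a.minus_right)
  with opt(2) show "a (u (Suc n)) (u (Suc n)) \<le> a (u n + z (Suc n)) (u n + z (Suc n)) / (norm (\<iota> (u n + z (Suc n))))\<^sup>2"
    by (simp add: v_def form_h_normalize)
  show "0 \<le> \<iota> (u n) \<bullet> \<iota> (u (Suc n))" by (simp add: u' \<iota>.neg)
qed

lemma prega_upto_norm:
  assumes D: "is_dictionary D" and u0: "norm (\<iota> u0) = 1"
    and run: "greedy_upto (prega_step a \<iota> \<nu> D) a u0 N u z lam"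
  shows "n \<le> N \<Longrightarrow> norm (\<iota> (u n)) = 1"
proof (induction n)
  case 0
  then show ?case using run u0 by (simp add: greedy_upto_def)
next
  case (Suc n)
  then have "norm (\<iota> (u n)) = 1" "lam n = a (u n) (u n)" "prega_step a \<iota> \<nu> D u z lam n"
    using run by (auto simp: greedy_upto_def)
  then show ?case by (rule prega_step_properties(1)[OF D])
qed

text \<open>Span membership is carried through the induction because each next step needs the
  current iterate in the search space.\<close>

lemma orega_upto_norm:
  assumes D: "is_dictionary D" and u0: "norm (\<iota> u0) = 1"
    and run: "greedy_upto (orega_step a \<iota> \<nu> D) a u0 N u z lam"
  shows "n \<le> N \<Longrightarrow> norm (\<iota> (u n)) = 1 \<and> u n \<in> span (insert (u 0) (z ` {1..n}))"
proof (induction n)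
  case 0
  then show ?case using run u0 by (simp add: greedy_upto_def span_base)
next
  case (Suc n)
  then have IH: "norm (\<iota> (u n)) = 1" "u n \<in> span (insert (u 0) (z ` {1..n}))" by auto
  have "lam n = a (u n) (u n)" "orega_step a \<iota> \<nu> D u z lam n"
    using run Suc.prems by (auto simp: greedy_upto_def)
  from orega_step_properties(1,2)[OF D IH(1) this(1) IH(2) this(2)] show ?case by blast
qed

text \<open>The premise \<open>acute\<close> is conditional on vanishing corrections: the pure
  algorithm obtains acute angles only from small corrections, the orthogonal one from its sign
  rule.\<close>

lemma greedy_sequence_conclusion:
  assumes sep: "separable_space (euclidean :: 'v topology)" and D: "is_dictionary D"
    and norm_u: "\<And>n. norm (\<iota> (u n)) = 1" and lam: "\<And>n. lam n = a (u n) (u n)"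
    and z: "\<And>n. z (Suc n) \<in> residual_argmin a \<iota> \<nu> D (u n) (lam n)"
    and improve: "\<And>n. lam (Suc n) \<le> a (u n + z (Suc n)) (u n + z (Suc n)) / (norm (\<iota> (u n + z (Suc n))))\<^sup>2"
    and acute: "(\<lambda>n. b (z (Suc n)) (z (Suc n))) \<longlonglongrightarrow> 0 \<Longrightarrow>
      \<forall>\<^sub>F n in sequentially. 0 \<le> \<iota> (u n) \<bullet> \<iota> (u (Suc n))"
    and ess: "ereal (lam 0) < spectral_min (essential_spectrum G)"
  shows "\<exists>l. decseq lam \<and> lam \<longlonglongrightarrow> l \<and> form_eigenvalue a \<iota> l \<and>
             ereal l < spectral_min (essential_spectrum G) \<and>
             bounded (range u) \<and>
             (\<forall>r w. strict_mono r \<and> limitin weak_topology (u \<circ> r) w sequentially \<longrightarrow>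
                w \<in> normalized_eigenvectors a \<iota> l \<and> (u \<circ> r) \<longlonglongrightarrow> w) \<and>
             (\<lambda>n. INF w\<in>normalized_eigenvectors a \<iota> l. energy_norm a \<iota> \<nu> (w - u n)) \<longlonglongrightarrow> 0 \<and>
             (dim (form_eigenspace a \<iota> l) = 1 \<longrightarrow>
                (\<exists>w\<in>normalized_eigenvectors a \<iota> l. u \<longlonglongrightarrow> w))"
proof -
  interpret greedy_sequence \<iota> a \<gamma> \<nu> D u z lam
    by unfold_locales (fact sep D norm_u lam z improve)+
  have "form_eigenvalue a \<iota> l"
    using eigenvector_exists[OF ess] by (auto simp: form_eigenvalue_def normalized_eigenvectors_def)
  then show ?thesis
    using decseq_lam lam_lim l_ess[OF ess] bounded_u weak_limit[OF ess] energy_distance_lim[OF ess]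
      simple_convergence[OF ess _ acute[OF z_lim]]
    by (intro exI[of _ l]) auto
qed

text \<open>Once the correction has H-norm at most \<open>1\<close>, its inner product with the unit
  vector \<open>\<iota> (u n)\<close> cannot outweigh \<open>1\<close>; the positive normalization
  factor keeps the sign.\<close>

lemma prega_acute:
  assumes norm_u: "\<And>n. norm (\<iota> (u n)) = 1"
    and u': "\<And>n. u (Suc n) = h_normalize \<iota> (u n + z (Suc n))"
    and z: "(\<lambda>n. b (z (Suc n)) (z (Suc n))) \<longlonglongrightarrow> 0"
  shows "\<forall>\<^sub>F n in sequentially. 0 \<le> \<iota> (u n) \<bullet> \<iota> (u (Suc n))"
proof -
  have "\<forall>\<^sub>F n in sequentially. b (z (Suc n)) (z (Suc n)) < 1"
    using z by (rule order_tendstoD) simp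
  then show ?thesis
  proof eventually_elim
    case (elim n)
    have "(norm (\<iota> (z (Suc n))))\<^sup>2 \<le> 1"
      using elim b_ge_inner[of "z (Suc n)"] by (simp add: power2_norm_eq_inner)
    then have "norm (\<iota> (z (Suc n))) \<le> 1" by (simp add: abs_square_le_1)
    then have "\<bar>\<iota> (u n) \<bullet> \<iota> (z (Suc n))\<bar> \<le> 1"
      using Cauchy_Schwarz_ineq2[of "\<iota> (u n)" "\<iota> (z (Suc n))"] norm_u[of n] by simp
    moreover have "\<iota> (u n) \<bullet> \<iota> (u n) = 1" using norm_u[of n] by (simp add: power2_norm_eq_inner[symmetric])
    ultimately have "0 \<le> \<iota> (u n) \<bullet> \<iota> (u n + z (Suc n))" by (simp add: \<iota>.add inner_add_right)
    then show ?case by (simp add: u' h_normalize_def \<iota>.scaleR)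
  qed
qed

lemma greedy_run_conclusion:
  assumes sep: "separable_space (euclidean :: 'v topology)" and D: "is_dictionary D"
    and u0: "norm (\<iota> u0) = 1" and ess: "ereal (a u0 u0) < spectral_min (essential_spectrum G)"
    and step: "step \<in> {prega_step a \<iota> \<nu> D, orega_step a \<iota> \<nu> D}"
    and run: "greedy_run step a u0 u z lam"
  shows "\<exists>l. decseq lam \<and> lam \<longlonglongrightarrow> l \<and> form_eigenvalue a \<iota> l \<and>
             ereal l < spectral_min (essential_spectrum G) \<and>
             bounded (range u) \<and>
             (\<forall>r w. strict_mono r \<and> limitin weak_topology (u \<circ> r) w sequentially \<longrightarrow>
                w \<in> normalized_eigenvectors a \<iota> l \<and> (u \<circ> r) \<longlonglongrightarrow> w) \<and>
             (\<lambda>n. INF w\<in>normalized_eigenvectors a \<iota> l. energy_norm a \<iota> \<nu> (w - u n)) \<longlonglongrightarrow> 0 \<and>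
             (dim (form_eigenspace a \<iota> l) = 1 \<longrightarrow>
                (\<exists>w\<in>normalized_eigenvectors a \<iota> l. u \<longlonglongrightarrow> w))"
proof -
  have upto: "greedy_upto step a u0 N u z lam" for N using run by (simp add: greedy_run_def)
  have lam: "lam n = a (u n) (u n)" and st: "step u z lam n" for n
    using upto[of "Suc n"] by (auto simp: greedy_upto_def)
  have "u 0 = u0" using upto by (simp add: greedy_upto_def)
  then have ess0: "ereal (lam 0) < spectral_min (essential_spectrum G)" using ess by (simp add: lam)
  consider "step = prega_step a \<iota> \<nu> D" | "step = orega_step a \<iota> \<nu> D" using step by blast
  then show ?thesis
  proof cases
    case 1
    have norm_u: "norm (\<iota> (u n)) = 1" for n
      using prega_upto_norm[OF D u0 upto[unfolded 1]] by blast
    have improve: "lam (Suc n) \<le> a (u n + z (Suc n)) (u n + z (Suc n)) / (norm (\<iota> (u n + z (Suc n))))\<^sup>2" for n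
      using prega_step_properties(2)[OF D norm_u lam st[unfolded 1]] by (simp add: lam)
    have z: "z (Suc n) \<in> residual_argmin a \<iota> \<nu> D (u n) (lam n)"
      and u': "u (Suc n) = h_normalize \<iota> (u n + z (Suc n))" for n
      using st[unfolded 1] by (auto simp: prega_step_def)
    show ?thesis
      by (rule greedy_sequence_conclusion[where u = u and z = z and lam = lam, OF sep D norm_u lam z improve _ ess0])
        (rule prega_acute[where u = u and z = z, OF norm_u u'])
  next
    case 2
    have norm_u: "norm (\<iota> (u n)) = 1" and span: "u n \<in> span (insert (u 0) (z ` {1..n}))" for n
      using orega_upto_norm[OF D u0 upto[unfolded 2], of n n] by auto
    note props = orega_step_properties[OF D norm_u lam span st[unfolded 2]]
    have z: "z (Suc n) \<in> residual_argmin a \<iota> \<nu> D (u n) (lam n)" for n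
      using st[of n, unfolded 2] by (simp add: orega_step_def)
    have improve: "lam (Suc n) \<le> a (u n + z (Suc n)) (u n + z (Suc n)) / (norm (\<iota> (u n + z (Suc n))))\<^sup>2" for n
      using props(3) by (simp add: lam)
    show ?thesis
      by (rule greedy_sequence_conclusion[where u = u and z = z and lam = lam, OF sep D norm_u lam z improve _ ess0]) (simp add: props(4))
  qed
qed

end

text \<open>Well-definedness is phrased over finite runs, so that it does not presuppose an infinite
  one; the update \<open>z(Suc N := \<zeta>)\<close> records an arbitrary outcome of the next
  residual minimization. Nonvanishing is included so that normalization never divides by
  zero.\<close>

theorem proposition3p1:
  fixes \<iota> :: "'v::{real_inner,complete_space} \<Rightarrow> 'h::{real_inner,complete_space}"
    and a :: "'v \<Rightarrow> 'v \<Rightarrow> real"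
    and \<gamma> \<nu> :: real
    and D :: "'v set"
    and u0 :: 'v
  assumes separable_V: "separable_space (euclidean :: 'v topology)"
    and separable_H: "separable_space (euclidean :: 'h topology)"
    and embedding: "bounded_linear \<iota>" "inj \<iota>" "closure (range \<iota>) = UNIV"
    and dictionary: "is_dictionary D"
    and form: "bounded_bilinear a" "\<And>v w. a v w = a w v"
    and constants: "\<gamma> > 0" "\<nu> > 0"
    and lower_bound: "\<And>v. a v v \<ge> \<gamma> * (norm v)\<^sup>2 - \<nu> * (norm (\<iota> v))\<^sup>2"
    and nu_choice: "\<And>v. energy_norm a \<iota> \<nu> v \<ge> norm (\<iota> v)"
    and gap: "spectral_min (op_spectrum (form_operator a \<iota>))
                < spectral_min (essential_spectrum (form_operator a \<iota>))"
    and initial: "norm (\<iota> u0) = 1"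
      "spectral_min (op_spectrum (form_operator a \<iota>)) \<le> ereal (a u0 u0)"
      "ereal (a u0 u0) < spectral_min (essential_spectrum (form_operator a \<iota>))"
  shows
    "(\<forall>N u z lam. greedy_upto (prega_step a \<iota> \<nu> D) a u0 N u z lam \<longrightarrow>
        residual_argmin a \<iota> \<nu> D (u N) (lam N) \<noteq> {} \<and>
        (\<forall>\<zeta>\<in>residual_argmin a \<iota> \<nu> D (u N) (lam N). u N + \<zeta> \<noteq> 0)) \<and>
     (\<forall>N u z lam. greedy_upto (orega_step a \<iota> \<nu> D) a u0 N u z lam \<longrightarrow>
        residual_argmin a \<iota> \<nu> D (u N) (lam N) \<noteq> {} \<and>
        (\<forall>\<zeta>\<in>residual_argmin a \<iota> \<nu> D (u N) (lam N).
           rayleigh_argmin a \<iota> u0 (z(Suc N := \<zeta>)) (Suc N) \<noteq> {} \<and>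
           (\<forall>c\<in>rayleigh_argmin a \<iota> u0 (z(Suc N := \<zeta>)) (Suc N).
              lin_comb u0 (z(Suc N := \<zeta>)) (Suc N) c \<noteq> 0))) \<and>
     (\<forall>step\<in>{prega_step a \<iota> \<nu> D, orega_step a \<iota> \<nu> D}. \<forall>u z lam.
        greedy_run step a u0 u z lam \<longrightarrow>
        (\<exists>l. decseq lam \<and> lam \<longlonglongrightarrow> l \<and> form_eigenvalue a \<iota> l \<and>
             ereal l < spectral_min (essential_spectrum (form_operator a \<iota>)) \<and>
             bounded (range u) \<and>
             (\<forall>r w. strict_mono r \<and> limitin weak_topology (u \<circ> r) w sequentially \<longrightarrow>
                w \<in> normalized_eigenvectors a \<iota> l \<and> (u \<circ> r) \<longlonglongrightarrow> w) \<and>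
             (\<lambda>n. INF w\<in>normalized_eigenvectors a \<iota> l. energy_norm a \<iota> \<nu> (w - u n)) \<longlonglongrightarrow> 0 \<and>
             (dim (form_eigenspace a \<iota> l) = 1 \<longrightarrow>
                (\<exists>w\<in>normalized_eigenvectors a \<iota> l. u \<longlonglongrightarrow> w))))"
proof -
  interpret embedded_form \<iota> a \<gamma> \<nu>
    by (rule embedded_form.intro) (fact embedding form constants lower_bound nu_choice)+
  show ?thesis
  proof (intro conjI allI impI)
    fix N u z lam assume run: "greedy_upto (prega_step a \<iota> \<nu> D) a u0 N u z lam"
    show "residual_argmin a \<iota> \<nu> D (u N) (lam N) \<noteq> {}"
      by (rule residual_argmin_nonempty[OF separable_V dictionary])
    have "lam N = a (u N) (u N)" using run by (simp add: greedy_upto_def)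
    then show "\<forall>\<zeta>\<in>residual_argmin a \<iota> \<nu> D (u N) (lam N). u N + \<zeta> \<noteq> 0"
      using residual_argmin_add_nonzero[OF dictionary prega_upto_norm[OF dictionary initial(1) run order_refl]]
      by simp
  next
    fix N u z lam assume "greedy_upto (orega_step a \<iota> \<nu> D) a u0 N u z lam"
    show "residual_argmin a \<iota> \<nu> D (u N) (lam N) \<noteq> {}"
      by (rule residual_argmin_nonempty[OF separable_V dictionary])
    \<comment> \<open>The initial vector is a nonzero competitor in every search space, which forces
      each Rayleigh minimizer to be nonzero.\<close>
    have "u0 \<noteq> 0" using initial(1) by auto
    then show "\<forall>\<zeta>\<in>residual_argmin a \<iota> \<nu> D (u N) (lam N).
           rayleigh_argmin a \<iota> u0 (z(Suc N := \<zeta>)) (Suc N) \<noteq> {} \<and>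
           (\<forall>c\<in>rayleigh_argmin a \<iota> u0 (z(Suc N := \<zeta>)) (Suc N).
              lin_comb u0 (z(Suc N := \<zeta>)) (Suc N) c \<noteq> 0)"
      by (intro ballI conjI rayleigh_argmin_nonempty[OF separable_V initial(1)])
        (rule rayleigh_argminD(1)[OF _ span_base[OF insertI1]])
  next
    show "\<forall>step\<in>{prega_step a \<iota> \<nu> D, orega_step a \<iota> \<nu> D}. \<forall>u z lam.
        greedy_run step a u0 u z lam \<longrightarrow>
        (\<exists>l. decseq lam \<and> lam \<longlonglongrightarrow> l \<and> form_eigenvalue a \<iota> l \<and>
             ereal l < spectral_min (essential_spectrum (form_operator a \<iota>)) \<and>
             bounded (range u) \<and>
             (\<forall>r w. strict_mono r \<and> limitin weak_topology (u \<circ> r) w sequentially \<longrightarrow>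
                w \<in> normalized_eigenvectors a \<iota> l \<and> (u \<circ> r) \<longlonglongrightarrow> w) \<and>
             (\<lambda>n. INF w\<in>normalized_eigenvectors a \<iota> l. energy_norm a \<iota> \<nu> (w - u n)) \<longlonglongrightarrow> 0 \<and>
             (dim (form_eigenspace a \<iota> l) = 1 \<longrightarrow>
                (\<exists>w\<in>normalized_eigenvectors a \<iota> l. u \<longlonglongrightarrow> w)))"
      by (intro ballI allI impI greedy_run_conclusion[OF separable_V dictionary initial(1) initial(3)])
  qed
qed

end
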